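(* Let $m\ge3$ be an integer and write $m=j2^k$ where either $j$ is odd with $j\ge3$ or $j=4$, and $k\ge0$ is an integer. Then for any non-simple accepting set $A\subseteq\{0,1,\dots,m-1\}$, \[\mathsf{UPP}(\mathrm{mod}_m^A\circ\mathsf{XOR})\ge\Omega\Big(\frac{n-km}{jm}\Big)-\frac{2j\log j}{m}.\]
   Context: For a positive integer $m<n$ and $A\subseteq\{0,\dots,m-1\}$, $\mathrm{mod}_m^A:\{0,1\}^n\to\{-1,1\}$ is $-1$ if $\sum_i x_i\equiv a\pmod m$ for some $a\in A$ and $1$ otherwise. $A$ is simple if $\mathrm{mod}_m^A$ is a constant function, the parity function, or its negation; otherwise non-simple. $(\mathrm{mod}_m^A\circ\mathsf{XOR})(x,y)=\mathrm{mod}_m^A(x\oplus y)$ for $x,y\in\{0,1\}^n$, Alice holding $x$, Bob $y$. For a two-party function $G$, $R_\epsilon(G)$ is the minimum worst-case communication of a private-coin randomized protocol that outputs $G(x,y)$ with probability $\ge1/2+\epsilon$ on every input, and $\mathsf{UPP}(G)=\min_{\epsilon>0}R_\epsilon(G)$. The $\Omega$ hides a universal positive constant. *)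

theory Defs
  imports "HOL-Probability.Probability" "HOL-Number_Theory.Cong"
begin

text \<open>
  Private-coin protocol trees. At an inner node the owning player sends one bit, computed from
  that player's own input and own random string: the first subtree is taken if the bit is
  \<^const>\<open>False\<close>, the second if it is \<^const>\<open>True\<close>. Leaves carry the output.
\<close>

datatype ('x, 'y, 'o) protocol =
    Output 'o
  | Alice "'x \<Rightarrow> bool list \<Rightarrow> bool" "('x, 'y, 'o) protocol" "('x, 'y, 'o) protocol"
  | Bob "'y \<Rightarrow> bool list \<Rightarrow> bool" "('x, 'y, 'o) protocol" "('x, 'y, 'o) protocol"

fun run :: "('x, 'y, 'o) protocol \<Rightarrow> 'x \<Rightarrow> 'y \<Rightarrow> bool list \<Rightarrow> bool list \<Rightarrow> 'o" where
  "run (Output v) x y r s = v"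
| "run (Alice f p q) x y r s = (if f x r then run q x y r s else run p x y r s)"
| "run (Bob g p q) x y r s = (if g y s then run q x y r s else run p x y r s)"

fun cost :: "('x, 'y, 'o) protocol \<Rightarrow> nat" where
  "cost (Output v) = 0"
| "cost (Alice f p q) = 1 + max (cost p) (cost q)"
| "cost (Bob g p q) = 1 + max (cost p) (cost q)"

text \<open>
  The two players' random strings are drawn independently, from arbitrary distributions.
\<close>

definition computes_with_advantage ::
  "'x set \<Rightarrow> 'y set \<Rightarrow> ('x \<Rightarrow> 'y \<Rightarrow> 'o) \<Rightarrow> real \<Rightarrow>
   ('x, 'y, 'o) protocol \<Rightarrow> bool list pmf \<Rightarrow> bool list pmf \<Rightarrow> bool" where
  "computes_with_advantage X Y G \<epsilon> p D\<^sub>A D\<^sub>B \<longleftrightarrow>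
     (\<forall>x\<in>X. \<forall>y\<in>Y.
        measure_pmf.prob (pair_pmf D\<^sub>A D\<^sub>B) {(r, s). run p x y r s = G x y} \<ge> 1 / 2 + \<epsilon>)"

text \<open>
  Values in \<^typ>\<open>enat\<close>, so that the complexity is \<open>\<infinity>\<close> (and not \<open>0\<close>) if no protocol
  achieves advantage \<open>\<epsilon>\<close>, e.g. for \<open>\<epsilon> > 1/2\<close>. Infima of nonempty sets of
  \<^typ>\<open>enat\<close> are minima.
\<close>

definition R_cc :: "'x set \<Rightarrow> 'y set \<Rightarrow> real \<Rightarrow> ('x \<Rightarrow> 'y \<Rightarrow> 'o) \<Rightarrow> enat" where
  "R_cc X Y \<epsilon> G = Inf {enat (cost p) | p D\<^sub>A D\<^sub>B. computes_with_advantage X Y G \<epsilon> p D\<^sub>A D\<^sub>B}"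

definition UPP :: "'x set \<Rightarrow> 'y set \<Rightarrow> ('x \<Rightarrow> 'y \<Rightarrow> 'o) \<Rightarrow> enat" where
  "UPP X Y G = (INF \<epsilon>\<in>{0<..}. R_cc X Y \<epsilon> G)"

definition cube :: "nat \<Rightarrow> bool list set" where
  "cube n = {x. length x = n}"

definition weight :: "bool list \<Rightarrow> nat" where
  "weight x = (\<Sum>i<length x. of_bool (x ! i))"

definition parity :: "bool list \<Rightarrow> int" where
  "parity x = (if odd (weight x) then - 1 else 1)"

definition mod_fn :: "nat \<Rightarrow> nat set \<Rightarrow> bool list \<Rightarrow> int" where
  "mod_fn m A x = (if \<exists>a\<in>A. [weight x = a] (mod m) then - 1 else 1)"

definition simple_accepting :: "nat \<Rightarrow> nat \<Rightarrow> nat set \<Rightarrow> bool" where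
  "simple_accepting n m A \<longleftrightarrow>
     (\<exists>b. \<forall>x\<in>cube n. mod_fn m A x = b) \<or>
     (\<forall>x\<in>cube n. mod_fn m A x = parity x) \<or>
     (\<forall>x\<in>cube n. mod_fn m A x = - parity x)"

definition xor_comp :: "(bool list \<Rightarrow> 'o) \<Rightarrow> bool list \<Rightarrow> bool list \<Rightarrow> 'o" where
  "xor_comp f x y = f (map2 (\<noteq>) x y)"

end

theory Submission imports Defs "HOL-Real_Asymp.Real_Asymp" begin

text \<open>
  A protocol of cost \<open>c\<close> with positive advantage gives a sign representation by vectors in dimension
  at most \<open>2 ^ c\<close>, so by Forster's theorem \<open>2 ^ c\<close> is at least the number of rows divided by the
  spectral norm of any matrix with the same signs and entries of absolute value at least 1.

  For odd period \<open>j\<close> one weights the two values so that the trivial character cancels, at the price of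
  a factor 2 in the mean absolute value; the remaining characters have norms decaying geometrically, and
  the bound is \<open>c \<ge> n / (4 * j\<^sup>2) - 3\<close>. A function of period 4 with
  \<open>h 0 \<noteq> h 2\<close> is restricted to inputs of even weight, where it becomes a single character. A general
  modulus is reduced to one of these cases by repeating every input bit \<open>2 ^ l\<close> times and padding by
  ones.

  Forster's theorem is proved without determinants or general position, by minimising
  \<open>\<Sum>x. ln \<bar>A u\<^sub>x\<bar>\<^sup>2 + \<beta> * \<bar>A\<bar>\<^sup>2\<close> over lower triangular \<open>A\<close> with positive diagonal of
  product 1: the minimum is attained, stationarity says that the second moment matrix of the normalised
  vectors plus \<open>\<beta> * A * A\<^sup>T\<close> is scalar, and the error vanishes as \<open>\<beta>\<close> tends to 0.
\<close>

section \<open>Radial isotropic position\<close>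

text \<open>A matrix is a function on index pairs, so that Tychonoff gives compactness in the
  product topology; only the leading \<open>r\<close> by \<open>r\<close> block counts.\<close>

definition tri_action :: "nat \<Rightarrow> (nat \<times> nat \<Rightarrow> real) \<Rightarrow> (nat \<Rightarrow> real) \<Rightarrow> nat \<Rightarrow> real" where
  "tri_action r A u i = (\<Sum>l<r. A (i, l) * u l)"

definition sq_norm :: "nat \<Rightarrow> (nat \<Rightarrow> real) \<Rightarrow> real" where
  "sq_norm r u = (\<Sum>i<r. (u i)\<^sup>2)"

text \<open>By the QL decomposition these matrices represent all matrices of determinant 1 up to an
  orthogonal left factor, which changes neither the norms of images nor \<open>frob\<close>.\<close>

definition unimod_tri :: "nat \<Rightarrow> (nat \<times> nat \<Rightarrow> real) \<Rightarrow> bool" where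
  "unimod_tri r A \<longleftrightarrow> (\<forall>i<r. A (i, i) > 0) \<and> (\<Prod>i<r. A (i, i)) = 1 \<and> (\<forall>i<r. \<forall>l<r. i < l \<longrightarrow> A (i, l) = 0)"

definition frob :: "nat \<Rightarrow> (nat \<times> nat \<Rightarrow> real) \<Rightarrow> real" where
  "frob r A = (\<Sum>i<r. \<Sum>l<r. (A (i, l))\<^sup>2)"

text \<open>Without the penalty the infimum need not be attained when the vectors are not in general
  position.\<close>

definition potential :: "nat \<Rightarrow> real \<Rightarrow> 'x set \<Rightarrow> ('x \<Rightarrow> nat \<Rightarrow> real) \<Rightarrow> (nat \<times> nat \<Rightarrow> real) \<Rightarrow> real" where
  "potential r \<beta> X u A = (\<Sum>x\<in>X. ln (sq_norm r (tri_action r A (u x)))) + \<beta> * frob r A"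

lemma sq_norm_nonneg: "sq_norm r u \<ge> 0"
  unfolding sq_norm_def by (simp add: sum_nonneg)

lemma component_le_sq_norm: "i < r \<Longrightarrow> (u i)\<^sup>2 \<le> sq_norm r u"
  unfolding sq_norm_def by (rule member_le_sum) auto

lemma first_nonzero_component:
  assumes "sq_norm r u > 0"
  obtains i where "i < r" "u i \<noteq> 0" "\<forall>l<i. u l = 0"
proof -
  have "\<exists>i<r. u i \<noteq> 0"
  proof (rule ccontr)
    assume "\<not> (\<exists>i<r. u i \<noteq> 0)"
    then have "sq_norm r u = 0" by (simp add: sq_norm_def)
    then show False using assms by simp
  qed
  then obtain i where i: "i < r" "u i \<noteq> 0" by auto
  define k where "k = (LEAST k. u k \<noteq> 0)"
  have "u k \<noteq> 0" unfolding k_def using i(2) by (rule LeastI)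
  moreover have "k \<le> i" unfolding k_def using i(2) by (rule Least_le)
  moreover have "\<forall>l<k. u l = 0" unfolding k_def using not_less_Least by blast
  ultimately show ?thesis using that[of k] i by auto
qed

lemma frob_nonneg: "frob r A \<ge> 0"
  unfolding frob_def by (simp add: sum_nonneg)

lemma component_le_frob:
  assumes "i < r" "l < r" shows "(A (i, l))\<^sup>2 \<le> frob r A"
proof -
  have "(A (i, l))\<^sup>2 \<le> (\<Sum>l<r. (A (i, l))\<^sup>2)" using assms by (intro member_le_sum) auto
  also have "\<dots> \<le> frob r A" unfolding frob_def
    using assms by (intro member_le_sum[where f = "\<lambda>i. \<Sum>l<r. (A (i, l))\<^sup>2"]) (auto intro: sum_nonneg)
  finally show ?thesis .
qed

text \<open>At the first nonzero coordinate of \<open>u\<close>, the triangular matrix only multiplies by its diagonal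
  entry, which is bounded below because the diagonal entries have product 1.\<close>

lemma sq_norm_tri_action_ge:
  assumes A: "unimod_tri r A" and i: "i < r" "u i \<noteq> 0" "\<forall>l<i. u l = 0"
  shows "sq_norm r (tri_action r A u) \<ge> (u i)\<^sup>2 * (A (i, i))\<^sup>2"
proof -
  have "tri_action r A u i = (\<Sum>l<r. if l = i then A (i, i) * u i else 0)"
    unfolding tri_action_def using A i
    by (intro sum.cong) (auto simp: unimod_tri_def, metis linorder_neqE_nat)
  also have "\<dots> = A (i, i) * u i" using i by simp
  finally show ?thesis using component_le_sq_norm[OF i(1), of "tri_action r A u"]
    by (simp add: power_mult_distrib mult.commute)
qed

lemma sq_norm_tri_action_pos:
  assumes A: "unimod_tri r A" and u: "sq_norm r u > 0"
  shows "sq_norm r (tri_action r A u) > 0"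
proof -
  obtain k where k: "k < r" "u k \<noteq> 0" "\<forall>l<k. u l = 0"
    using first_nonzero_component[OF u] by metis
  then have "A (k, k) > 0" using A by (auto simp: unimod_tri_def)
  then have "0 < (u k)\<^sup>2 * (A (k, k))\<^sup>2" using k by simp
  also have "\<dots> \<le> sq_norm r (tri_action r A u)" using A k by (intro sq_norm_tri_action_ge) auto
  finally show ?thesis .
qed

section \<open>Coercivity of the potential and existence of a minimiser\<close>

text \<open>The other \<open>r - 1\<close> diagonal entries are at most \<open>K\<close> and the
  product is 1; the exponent \<open>r\<close> is a harmless weakening.\<close>

lemma unimod_tri_diag_ge:
  assumes A: "unimod_tri r A" and i: "i < r" and K: "frob r A \<le> K\<^sup>2" "K \<ge> 1"
  shows "A (i, i) \<ge> 1 / K ^ r"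
proof -
  have pos: "A (l, l) > 0" if "l < r" for l using A that by (auto simp: unimod_tri_def)
  have le: "A (l, l) \<le> K" if "l < r" for l
  proof (rule power2_le_imp_le)
    show "(A (l, l))\<^sup>2 \<le> K\<^sup>2" using component_le_frob[OF that that, of A] K(1) by linarith
  qed (use K in simp)
  have "(\<Prod>l<r. A (l, l)) = A (i, i) * (\<Prod>l\<in>{..<r} - {i}. A (l, l))"
    using i by (intro prod.remove) auto
  then have "1 = A (i, i) * (\<Prod>l\<in>{..<r} - {i}. A (l, l))" using A by (simp add: unimod_tri_def)
  also have "\<dots> \<le> A (i, i) * (\<Prod>l\<in>{..<r} - {i}. K)"
    using pos le i by (intro mult_left_mono prod_mono) (auto intro: less_imp_le)
  also have "\<dots> = A (i, i) * K ^ (r - 1)" using i by simp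
  also have "\<dots> \<le> A (i, i) * K ^ r"
    using K pos[OF i] by (intro mult_left_mono power_increasing) auto
  finally have "1 \<le> A (i, i) * K ^ r" .
  then show ?thesis using K by (simp add: divide_simps)
qed

text \<open>When \<open>frob r A = K\<^sup>2\<close>, the logarithms lose at most a multiple of
  \<open>ln K\<close>, by the estimate at the first nonzero coordinate, while the penalty grows like
  \<open>K\<^sup>2\<close>.\<close>

lemma potential_coercive:
  assumes r: "r > 0" and b: "\<beta> > 0" and X: "finite X" and u: "\<And>x. x \<in> X \<Longrightarrow> sq_norm r (u x) > 0"
  shows "\<exists>K\<ge>1. \<forall>A. unimod_tri r A \<and> potential r \<beta> X u A \<le> C \<longrightarrow> frob r A \<le> K\<^sup>2"
proof -
  have "\<exists>i. i < r \<and> u x i \<noteq> 0 \<and> (\<forall>l<i. u x l = 0)" if "x \<in> X" for x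
    using first_nonzero_component[OF u[OF that]] by metis
  then obtain p where p: "\<And>x. x \<in> X \<Longrightarrow> p x < r \<and> u x (p x) \<noteq> 0 \<and> (\<forall>l<p x. u x l = 0)" by metis
  define D where "D = (\<Sum>x\<in>X. ln ((u x (p x))\<^sup>2))"
  have lower: "potential r \<beta> X u A \<ge> D - 2 * real r * real (card X) * ln K + \<beta> * K\<^sup>2"
    if A: "unimod_tri r A" and K: "frob r A = K\<^sup>2" "K \<ge> 1" for A K
  proof -
    have "ln (sq_norm r (tri_action r A (u x))) \<ge> ln ((u x (p x))\<^sup>2) - 2 * real r * ln K" if x: "x \<in> X" for x
    proof -
      have "ln ((u x (p x))\<^sup>2) - 2 * real r * ln K = ln ((u x (p x))\<^sup>2 * (1 / K ^ r)\<^sup>2)"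
        using p[OF x] K by (simp add: ln_mult ln_div ln_realpow)
      also have "\<dots> \<le> ln (sq_norm r (tri_action r A (u x)))"
      proof (rule ln_mono)
        have "(1 / K ^ r)\<^sup>2 \<le> (A (p x, p x))\<^sup>2"
          using unimod_tri_diag_ge[OF A _ _ K(2), of "p x"] p[OF x] K by (intro power_mono) auto
        then have "(u x (p x))\<^sup>2 * (1 / K ^ r)\<^sup>2 \<le> (u x (p x))\<^sup>2 * (A (p x, p x))\<^sup>2"
          by (intro mult_left_mono) auto
        also have "\<dots> \<le> sq_norm r (tri_action r A (u x))"
          using sq_norm_tri_action_ge[OF A, of "p x" "u x"] p[OF x] by auto
        finally show "(u x (p x))\<^sup>2 * (1 / K ^ r)\<^sup>2 \<le> sq_norm r (tri_action r A (u x))" .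
      qed (use p[OF x] K in auto)
      finally show ?thesis .
    qed
    then have "(\<Sum>x\<in>X. ln (sq_norm r (tri_action r A (u x)))) \<ge> (\<Sum>x\<in>X. ln ((u x (p x))\<^sup>2) - 2 * real r * ln K)"
      by (intro sum_mono)
    then show ?thesis unfolding potential_def K D_def by (simp add: sum_subtractf algebra_simps)
  qed
  have "filterlim (\<lambda>K. D - 2 * real r * real (card X) * ln K + \<beta> * K\<^sup>2) at_top at_top"
    using b by real_asymp
  then have "eventually (\<lambda>K. D - 2 * real r * real (card X) * ln K + \<beta> * K\<^sup>2 > C) at_top"
    by (simp add: filterlim_at_top_dense)
  then obtain K0 where K0: "\<And>K. K \<ge> K0 \<Longrightarrow> D - 2 * real r * real (card X) * ln K + \<beta> * K\<^sup>2 > C"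
    by (auto simp: eventually_at_top_linorder)
  show ?thesis
  proof (intro exI[of _ "max 1 K0"] conjI allI impI)
    fix A assume A: "unimod_tri r A \<and> potential r \<beta> X u A \<le> C"
    show "frob r A \<le> (max 1 K0)\<^sup>2"
    proof (rule ccontr)
      assume "\<not> ?thesis"
      then have "sqrt (frob r A) > max 1 K0" by (intro real_less_rsqrt) auto
      then show False using lower[of A "sqrt (frob r A)"] K0[of "sqrt (frob r A)"] A frob_nonneg[of r A] by auto
    qed
  qed auto
qed

lemma compact_function_box:
  fixes S :: "'i \<Rightarrow> 'a::topological_space set"
  assumes "\<And>i. compact (S i)"
  shows "compact {f. \<forall>i. f i \<in> S i}"
proof -
  have "compactin (product_topology (\<lambda>i. euclidean) UNIV) (PiE UNIV S)"
    using assms by (subst compactin_PiE) auto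
  moreover have "PiE UNIV S = {f. \<forall>i. f i \<in> S i}" by (auto simp: PiE_def Pi_def)
  ultimately show ?thesis by (simp add: euclidean_product_topology)
qed

text \<open>Coercivity confines every competitor no worse than the identity to a compact box, where
  continuity gives a minimum.\<close>

lemma potential_attains_min:
  assumes r: "r > 0" and b: "\<beta> > 0" and X: "finite X" and u: "\<And>x. x \<in> X \<Longrightarrow> sq_norm r (u x) > 0"
  obtains A where "unimod_tri r A" "\<And>B. unimod_tri r B \<Longrightarrow> potential r \<beta> X u A \<le> potential r \<beta> X u B"
proof -
  define I where "I = (\<lambda>(i, l). if i = l \<and> i < r then 1 else (0::real))"
  have I: "unimod_tri r I" by (auto simp: unimod_tri_def I_def)
  obtain K where K: "K \<ge> 1"
    "\<And>A. unimod_tri r A \<Longrightarrow> potential r \<beta> X u A \<le> potential r \<beta> X u I \<Longrightarrow> frob r A \<le> K\<^sup>2"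
    using potential_coercive[where C = "potential r \<beta> X u I" and u = u, OF r b X u] by auto
  \<comment> \<open>The lower bound \<open>1 / K ^ r\<close> replaces the open condition of a
    positive diagonal by a closed one. Columns from \<open>r\<close> on fall under
    \<open>i \<ge> r \<or> i < l\<close>, so everything outside the block is 0.\<close>
  define S where "S = (\<lambda>(i, l). if i \<ge> r \<or> i < l then {0} else if i = l then {1 / K ^ r .. K} else {-K .. K})"
  define Z where "Z = {f. \<forall>p. f p \<in> S p} \<inter> {f. (\<Prod>i<r. f (i, i)) = 1}"
  have cont: "continuous_on T (\<lambda>f::nat \<times> nat \<Rightarrow> real. f p)" for T p
    by (rule continuous_on_subset[OF continuous_on_product_coordinates]) auto
  have "compact {f. \<forall>p. f p \<in> S p}" by (rule compact_function_box) (auto simp: S_def)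
  moreover have "closed {f :: nat \<times> nat \<Rightarrow> real. (\<Prod>i<r. f (i, i)) = 1}"
    by (intro closed_Collect_eq continuous_intros cont)
  ultimately have Zc: "compact Z" unfolding Z_def by (rule compact_Int_closed)
  have Ztri: "unimod_tri r A" if "A \<in> Z" for A
  proof -
    have "A (i, i) > 0" if "i < r" for i
    proof -
      have "A (i, i) \<in> {1 / K ^ r .. K}" using \<open>A \<in> Z\<close> \<open>i < r\<close> unfolding Z_def S_def
        by (auto dest!: spec[of _ "(i, i)"] simp del: split_paired_All)
      moreover have "1 / K ^ r > 0" using K by simp
      ultimately show ?thesis by (meson atLeastAtMost_iff less_le_trans)
    qed
    moreover have "A (i, l) = 0" if "i < l" for i l
      using \<open>A \<in> Z\<close> that unfolding Z_def S_def
      by (auto dest!: spec[of _ "(i, l)"] simp del: split_paired_All)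
    ultimately show ?thesis using that unfolding unimod_tri_def Z_def by auto
  qed
  have pos: "sq_norm r (tri_action r A (u x)) > 0" if A: "unimod_tri r A" and x: "x \<in> X" for A x
    by (rule sq_norm_tri_action_pos[OF that(1) u[OF x]])
  have "continuous_on Z (potential r \<beta> X u)"
    unfolding potential_def sq_norm_def tri_action_def frob_def
  proof (intro continuous_intros cont ballI)
    fix x A assume "x \<in> X" "A \<in> Z"
    then have "sq_norm r (tri_action r A (u x)) > 0" using pos Ztri by blast
    then show "(\<Sum>i<r. (\<Sum>l<r. A (i, l) * u x l)\<^sup>2) \<noteq> 0" by (simp add: sq_norm_def tri_action_def)
  qed
  \<comment> \<open>Zeroing the entries outside the block does not change the potential, so
    competitors may be assumed to lie in \<open>Z\<close>.\<close>
  have trunc: "\<exists>B\<in>Z. potential r \<beta> X u B = potential r \<beta> X u A"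
    if A: "unimod_tri r A" and le: "potential r \<beta> X u A \<le> potential r \<beta> X u I" for A
  proof -
    define B where "B = (\<lambda>(i, l). if i < r \<and> l < r then A (i, l) else 0)"
    have eq: "potential r \<beta> X u B = potential r \<beta> X u A"
      unfolding potential_def sq_norm_def tri_action_def frob_def B_def by simp
    have fr: "frob r A \<le> K\<^sup>2" using K A le by auto
    have bd: "\<bar>A (i, l)\<bar> \<le> K" if "i < r" "l < r" for i l
      using component_le_frob[OF that, of A] fr K abs_le_square_iff[of "A (i, l)" K] by linarith
    have "B p \<in> S p" for p
    proof (cases p)
      case (Pair i l)
      show ?thesis
      proof (cases "i < r \<and> l < r")
        case True
        have "1 / K ^ r \<le> A (i, i)" using unimod_tri_diag_ge[OF A _ fr K(1), of i] True by blast
        moreover have "i < l \<Longrightarrow> A (i, l) = 0" using A True by (simp add: unimod_tri_def)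
        moreover have "A (i, l) \<le> K \<and> - K \<le> A (i, l)" using bd[of i l] True by (simp add: abs_le_iff)
        ultimately show ?thesis using True Pair by (cases "i = l") (simp_all add: S_def B_def)
      next
        case False
        then have "B p = 0" using Pair by (auto simp: B_def)
        moreover have "0 \<in> S p" using False Pair K by (auto simp: S_def)
        ultimately show ?thesis by simp
      qed
    qed
    moreover have "(\<Prod>i<r. B (i, i)) = 1" using A by (simp add: unimod_tri_def B_def)
    ultimately have "B \<in> Z" unfolding Z_def by blast
    then show ?thesis using eq by blast
  qed
  obtain B0 where B0: "B0 \<in> Z" "potential r \<beta> X u B0 = potential r \<beta> X u I" using trunc[OF I] by blast
  obtain A where A: "A \<in> Z" "\<And>B. B \<in> Z \<Longrightarrow> potential r \<beta> X u A \<le> potential r \<beta> X u B"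
    using continuous_attains_inf[OF Zc _ \<open>continuous_on Z (potential r \<beta> X u)\<close>] B0 by auto
  show ?thesis
  proof (rule that)
    show "unimod_tri r A" using A Ztri by auto
    fix B assume B: "unimod_tri r B"
    show "potential r \<beta> X u A \<le> potential r \<beta> X u B"
    proof (cases "potential r \<beta> X u B \<le> potential r \<beta> X u I")
      case True then show ?thesis using trunc[OF B True] A by force
    next
      case False then show ?thesis using A(2)[OF B0(1)] B0(2) by auto
    qed
  qed
qed

section \<open>First variation of the potential\<close>

text \<open>Fermat's rule along an arbitrary differentiable curve of admissible matrices through the
  minimiser; the left-hand side is half the derivative at 0.\<close>

lemma potential_stationary:
  assumes X: "finite X" and u: "\<And>x. x \<in> X \<Longrightarrow> sq_norm r (u x) > 0"
    and A: "unimod_tri r A" and min: "\<And>B. unimod_tri r B \<Longrightarrow> potential r \<beta> X u A \<le> potential r \<beta> X u B"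
    and B: "\<And>t. unimod_tri r (B t)" "B 0 = A"
    and B': "\<And>p. ((\<lambda>t. B t p) has_real_derivative B' p) (at 0)"
  shows "(\<Sum>x\<in>X. (\<Sum>i<r. tri_action r A (u x) i * tri_action r B' (u x) i) / sq_norm r (tri_action r A (u x)))
    + \<beta> * (\<Sum>i<r. \<Sum>l<r. A (i, l) * B' (i, l)) = 0" (is "?S + ?F = 0")
proof -
  have act: "((\<lambda>t. tri_action r (B t) v i) has_real_derivative tri_action r B' v i) (at 0)" for v i
    unfolding tri_action_def using B' by (auto intro!: derivative_eq_intros)
  have sq: "((\<lambda>t. sq_norm r (tri_action r (B t) v)) has_real_derivative
      2 * (\<Sum>i<r. tri_action r A v i * tri_action r B' v i)) (at 0)" for v
    unfolding sq_norm_def using act B(2)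
    by (auto intro!: derivative_eq_intros simp: sum_distrib_left mult_ac intro!: sum.cong)
  have ln: "((\<lambda>t. ln (sq_norm r (tri_action r (B t) (u x)))) has_real_derivative
      2 * (\<Sum>i<r. tri_action r A (u x) i * tri_action r B' (u x) i) / sq_norm r (tri_action r A (u x))) (at 0)"
    if "x \<in> X" for x
    using sq_norm_tri_action_pos[OF A u[OF that]] B(2)
    by (intro DERIV_ln_divide[THEN DERIV_chain2, THEN DERIV_cong, OF _ sq]) auto
  have fr: "((\<lambda>t. frob r (B t)) has_real_derivative 2 * (\<Sum>i<r. \<Sum>l<r. A (i, l) * B' (i, l))) (at 0)"
    unfolding frob_def using B' B(2)
    by (auto intro!: derivative_eq_intros simp: sum_distrib_left mult_ac intro!: sum.cong)
  have "((\<lambda>t. potential r \<beta> X u (B t)) has_real_derivative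
     (\<Sum>x\<in>X. 2 * (\<Sum>i<r. tri_action r A (u x) i * tri_action r B' (u x) i) / sq_norm r (tri_action r A (u x)))
      + \<beta> * (2 * (\<Sum>i<r. \<Sum>l<r. A (i, l) * B' (i, l)))) (at 0)"
    unfolding potential_def by (intro DERIV_add DERIV_sum DERIV_cmult ln fr)
  then have "(\<Sum>x\<in>X. 2 * (\<Sum>i<r. tri_action r A (u x) i * tri_action r B' (u x) i) / sq_norm r (tri_action r A (u x)))
      + \<beta> * (2 * (\<Sum>i<r. \<Sum>l<r. A (i, l) * B' (i, l))) = 0"
    by (rule DERIV_local_min[of _ _ _ 1]) (use min B in auto)
  also have "(\<Sum>x\<in>X. 2 * (\<Sum>i<r. tri_action r A (u x) i * tri_action r B' (u x) i) / sq_norm r (tri_action r A (u x)))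
      + \<beta> * (2 * (\<Sum>i<r. \<Sum>l<r. A (i, l) * B' (i, l))) = 2 * (?S + ?F)"
    by (simp add: sum_distrib_left algebra_simps)
  finally show ?thesis by simp
qed

text \<open>The matrix that stationarity forces to be scalar.\<close>

definition moment :: "nat \<Rightarrow> real \<Rightarrow> 'x set \<Rightarrow> ('x \<Rightarrow> nat \<Rightarrow> real) \<Rightarrow> (nat \<times> nat \<Rightarrow> real) \<Rightarrow> nat \<Rightarrow> nat \<Rightarrow> real" where
  "moment r \<beta> X u A i k =
    (\<Sum>x\<in>X. tri_action r A (u x) i * tri_action r A (u x) k / sq_norm r (tri_action r A (u x)))
    + \<beta> * (\<Sum>l<r. A (i, l) * A (k, l))"

lemma moment_sym: "moment r \<beta> X u A i k = moment r \<beta> X u A k i"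
  unfolding moment_def by (simp add: mult.commute)

text \<open>Variation: add \<open>t\<close> times row \<open>k\<close> to row \<open>i\<close>. For
  \<open>k < i\<close> this keeps lower triangularity and the diagonal, and the first variation is
  the entry itself.\<close>

lemma moment_offdiag:
  assumes X: "finite X" and u: "\<And>x. x \<in> X \<Longrightarrow> sq_norm r (u x) > 0"
    and A: "unimod_tri r A" and min: "\<And>B. unimod_tri r B \<Longrightarrow> potential r \<beta> X u A \<le> potential r \<beta> X u B"
    and i: "k < i" "i < r"
  shows "moment r \<beta> X u A i k = 0"
proof -
  define B where "B = (\<lambda>t (a, l). A (a, l) + (if a = i then t * A (k, l) else 0))"
  define B' where "B' = (\<lambda>(a, l). if a = i then A (k, l) else 0)"
  have diag: "B t (a, a) = A (a, a)" if "a < r" for a t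
    using A i that by (auto simp: B_def unimod_tri_def)
  have tri: "unimod_tri r (B t)" for t
    unfolding unimod_tri_def using A i by (auto simp: diag) (auto simp: unimod_tri_def B_def)
  have act: "tri_action r B' v a = (if a = i then tri_action r A v k else 0)" for v a
    by (simp add: tri_action_def B'_def)
  have "(\<Sum>x\<in>X. (\<Sum>a<r. tri_action r A (u x) a * tri_action r B' (u x) a) / sq_norm r (tri_action r A (u x)))
    + \<beta> * (\<Sum>a<r. \<Sum>l<r. A (a, l) * B' (a, l)) = 0"
    by (rule potential_stationary[OF X u A min tri])
       (auto simp: B_def B'_def fun_eq_iff intro!: derivative_eq_intros)
  moreover have "(\<Sum>a<r. tri_action r A v a * tri_action r B' v a) = tri_action r A v i * tri_action r A v k" for v
    using i by (simp add: act if_distrib cong: if_cong)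
  moreover have "(\<Sum>a<r. \<Sum>l<r. A (a, l) * B' (a, l)) = (\<Sum>l<r. A (i, l) * A (k, l))"
  proof -
    have "(\<Sum>a<r. \<Sum>l<r. A (a, l) * B' (a, l)) = (\<Sum>a<r. if a = i then \<Sum>l<r. A (i, l) * A (k, l) else 0)"
      by (intro sum.cong) (auto simp: B'_def)
    then show ?thesis using i by simp
  qed
  ultimately show ?thesis by (simp add: moment_def)
qed

text \<open>Variation: scale row \<open>i\<close> by \<open>exp t\<close> and row \<open>k\<close>
  by \<open>exp (- t)\<close>, which keeps the diagonal product; the first variation is the
  difference of the two diagonal entries.\<close>

lemma moment_diag:
  assumes X: "finite X" and u: "\<And>x. x \<in> X \<Longrightarrow> sq_norm r (u x) > 0"
    and A: "unimod_tri r A" and min: "\<And>B. unimod_tri r B \<Longrightarrow> potential r \<beta> X u A \<le> potential r \<beta> X u B"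
    and i: "i < r" "k < r"
  shows "moment r \<beta> X u A i i = moment r \<beta> X u A k k"
proof (cases "i = k")
  case False
  define s where "s = (\<lambda>a. if a = i then 1 else if a = k then - 1 else (0::real))"
  define B where "B = (\<lambda>t (a, l). exp (t * s a) * A (a, l))"
  define B' where "B' = (\<lambda>(a, l). s a * A (a, l))"
  have "(\<Prod>a<r. exp (t * s a)) = 1" for t
  proof -
    have "(\<Sum>a<r. t * s a) = (\<Sum>a<r. (if a = i then t else 0) - (if a = k then t else 0))"
      using False by (intro sum.cong) (auto simp: s_def)
    then show ?thesis using i by (simp add: exp_sum[symmetric] sum_subtractf)
  qed
  then have tri: "unimod_tri r (B t)" for t
    using A by (simp add: unimod_tri_def B_def prod.distrib)
  have act: "tri_action r B' v a = s a * tri_action r A v a" for v a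
    by (simp add: tri_action_def B'_def sum_distrib_left mult_ac)
  have pick: "(\<Sum>a<r. s a * f a) = f i - f k" for f
  proof -
    have "(\<Sum>a<r. s a * f a) = (\<Sum>a<r. (if a = i then f a else 0) - (if a = k then f a else 0))"
      using False by (intro sum.cong) (auto simp: s_def)
    then show ?thesis using i by (simp add: sum_subtractf)
  qed
  have "(\<Sum>x\<in>X. (\<Sum>a<r. tri_action r A (u x) a * tri_action r B' (u x) a) / sq_norm r (tri_action r A (u x)))
    + \<beta> * (\<Sum>a<r. \<Sum>l<r. A (a, l) * B' (a, l)) = 0"
    by (rule potential_stationary[OF X u A min tri])
       (auto simp: B_def B'_def fun_eq_iff intro!: derivative_eq_intros)
  moreover have "(\<Sum>a<r. tri_action r A v a * tri_action r B' v a)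
      = tri_action r A v i * tri_action r A v i - tri_action r A v k * tri_action r A v k" for v
    using pick[of "\<lambda>a. tri_action r A v a * tri_action r A v a"] by (simp add: act mult_ac)
  moreover have "(\<Sum>a<r. \<Sum>l<r. A (a, l) * B' (a, l)) = (\<Sum>l<r. A (i, l) * A (i, l)) - (\<Sum>l<r. A (k, l) * A (k, l))"
    using pick[of "\<lambda>a. \<Sum>l<r. A (a, l) * A (a, l)"] by (simp add: B'_def sum_distrib_left mult_ac)
  ultimately show ?thesis by (simp add: moment_def diff_divide_distrib sum_subtractf algebra_simps)
qed simp

lemma sum_squares_as_quadratic_form:
  fixes f :: "'x \<Rightarrow> nat \<Rightarrow> real"
  shows "(\<Sum>x\<in>X. (\<Sum>i<r. f x i * w i)\<^sup>2 / c x) = (\<Sum>i<r. \<Sum>k<r. w i * w k * (\<Sum>x\<in>X. f x i * f x k / c x))"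
proof -
  have "(\<Sum>i<r. f x i * w i)\<^sup>2 / c x = (\<Sum>i<r. \<Sum>k<r. w i * w k * (f x i * f x k / c x))" for x
    by (simp add: power2_eq_square sum_product sum_divide_distrib mult_ac)
  then have "(\<Sum>x\<in>X. (\<Sum>i<r. f x i * w i)\<^sup>2 / c x)
      = (\<Sum>x\<in>X. \<Sum>i<r. \<Sum>k<r. w i * w k * (f x i * f x k / c x))" by simp
  also have "\<dots> = (\<Sum>i<r. \<Sum>x\<in>X. \<Sum>k<r. w i * w k * (f x i * f x k / c x))" by (rule sum.swap)
  also have "\<dots> = (\<Sum>i<r. \<Sum>k<r. \<Sum>x\<in>X. w i * w k * (f x i * f x k / c x))"
    by (intro sum.cong refl sum.swap)
  finally show ?thesis by (simp add: sum_distrib_left)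
qed

text \<open>The moment matrix is \<open>\<kappa>\<close> times the identity, so its quadratic form
  at \<open>w\<close> is \<open>\<kappa> * sq_norm r w\<close>, and its trace bounds
  \<open>\<kappa>\<close> from below.\<close>

lemma minimizer_isotropic:
  assumes r: "r > 0" and b: "\<beta> \<ge> 0"
    and X: "finite X" and u: "\<And>x. x \<in> X \<Longrightarrow> sq_norm r (u x) > 0"
    and A: "unimod_tri r A" and min: "\<And>B. unimod_tri r B \<Longrightarrow> potential r \<beta> X u A \<le> potential r \<beta> X u B"
  shows "(\<Sum>x\<in>X. (\<Sum>i<r. tri_action r A (u x) i * w i)\<^sup>2 / sq_norm r (tri_action r A (u x)))
    + \<beta> * (\<Sum>l<r. (\<Sum>i<r. A (i, l) * w i)\<^sup>2) \<ge> real (card X) / real r * sq_norm r w"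
proof -
  let ?T = "moment r \<beta> X u A"
  let ?p = "\<lambda>x. tri_action r A (u x)"
  define \<kappa> where "\<kappa> = ?T 0 0"
  have off: "?T i k = 0" if "i \<noteq> k" "i < r" "k < r" for i k
    using moment_offdiag[OF X u A min] moment_sym[of r \<beta> X u A i k] that by (cases i k rule: linorder_cases) auto
  have diag: "?T i i = \<kappa>" if "i < r" for i
    unfolding \<kappa>_def by (rule moment_diag[OF X u A min that r])
  \<comment> \<open>Trace: every normalised image contributes 1, giving
    \<open>real (card X) + \<beta> * frob r A\<close>.\<close>
  have "real r * \<kappa> = (\<Sum>i<r. ?T i i)" by (simp add: diag)
  also have "\<dots> = (\<Sum>i<r. \<Sum>x\<in>X. ?p x i * ?p x i / sq_norm r (?p x)) + \<beta> * frob r A"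
    by (simp add: moment_def sum.distrib frob_def sum_distrib_left power2_eq_square)
  also have "(\<Sum>i<r. \<Sum>x\<in>X. ?p x i * ?p x i / sq_norm r (?p x)) = (\<Sum>x\<in>X. sq_norm r (?p x) / sq_norm r (?p x))"
    by (subst sum.swap, subst sum_divide_distrib[symmetric]) (simp add: sq_norm_def power2_eq_square)
  also have "\<dots> = real (card X)"
    using sq_norm_tri_action_pos[OF A u] by (simp add: less_imp_neq[symmetric])
  finally have "real r * \<kappa> \<ge> real (card X)" using b frob_nonneg[of r A] by simp
  then have \<kappa>: "\<kappa> \<ge> real (card X) / real r" using r by (simp add: divide_simps mult.commute)
  have "(\<Sum>x\<in>X. (\<Sum>i<r. ?p x i * w i)\<^sup>2 / sq_norm r (?p x)) + \<beta> * (\<Sum>l<r. (\<Sum>i<r. A (i, l) * w i)\<^sup>2)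
    = (\<Sum>i<r. \<Sum>k<r. w i * w k * (\<Sum>x\<in>X. ?p x i * ?p x k / sq_norm r (?p x)))
      + \<beta> * (\<Sum>i<r. \<Sum>k<r. w i * w k * (\<Sum>l<r. A (i, l) * A (k, l)))"
    using sum_squares_as_quadratic_form[where f = ?p and c = "\<lambda>x. sq_norm r (?p x)"]
      sum_squares_as_quadratic_form[where f = "\<lambda>l i. A (i, l)" and c = "\<lambda>_. 1" and X = "{..<r}"] by simp
  also have "\<dots> = (\<Sum>i<r. \<Sum>k<r. w i * w k * ?T i k)"
    by (simp add: moment_def sum.distrib sum_distrib_left algebra_simps)
  also have "\<dots> = (\<Sum>i<r. \<Sum>k<r. if k = i then w i * w i * \<kappa> else 0)"
    by (intro sum.cong) (auto simp: off diag)
  also have "\<dots> = \<kappa> * sq_norm r w"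
    by (simp add: sq_norm_def power2_eq_square sum_distrib_left mult_ac)
  finally show ?thesis using mult_right_mono[OF \<kappa> sq_norm_nonneg[of r w]] by simp
qed

section \<open>Forster's sign-rank bound\<close>

text \<open>Back substitution for the transposed system, from the last unknown down. It supplies the
  inverse transpose action, which preserves inner products.\<close>

lemma triangular_transpose_solve:
  fixes A :: "nat \<times> nat \<Rightarrow> real"
  assumes "\<forall>i<r. A (i, i) \<noteq> 0" "\<forall>i<r. \<forall>l<r. i < l \<longrightarrow> A (i, l) = 0"
  shows "\<exists>w. \<forall>l<r. (\<Sum>i<r. A (i, l) * w i) = v l"
  using assms
proof (induction r arbitrary: v)
  case (Suc r)
  define c where "c = v r / A (r, r)"
  obtain w where w: "\<forall>l<r. (\<Sum>i<r. A (i, l) * w i) = v l - A (r, l) * c"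
    using Suc.IH[of "\<lambda>l. v l - A (r, l) * c"] Suc.prems by (metis less_Suc_eq)
  have "(\<Sum>i<r. A (i, l) * (w(r := c)) i) = (\<Sum>i<r. A (i, l) * w i)" for l
    by (intro sum.cong) auto
  moreover have "(\<Sum>i<r. A (i, r) * w i) = 0" using Suc.prems by (intro sum.neutral) auto
  moreover have "A (r, r) * c = v r" using Suc.prems by (simp add: c_def)
  ultimately have "\<forall>l<Suc r. (\<Sum>i<Suc r. A (i, l) * (w(r := c)) i) = v l"
    using w by (auto simp: less_Suc_eq)
  then show ?case by blast
qed simp

text \<open>Move \<open>u\<close> by the minimiser and \<open>v\<close> by its inverse transpose, so
  that inner products are unchanged, and normalise. Isotropy bounds the sum of
  \<open>M x y * c x y\<close> from below; the hypothesis on \<open>\<Lambda>\<close>, a spectral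
  norm bound weakened by the arithmetic-geometric mean inequality, bounds it from above. The point
  is that \<open>C\<close> does not depend on \<open>\<beta>\<close>.\<close>

lemma forster_perturbed:
  fixes u :: "'x \<Rightarrow> nat \<Rightarrow> real" and v :: "'y \<Rightarrow> nat \<Rightarrow> real" and M :: "'x \<Rightarrow> 'y \<Rightarrow> real"
  assumes X: "finite X" "X \<noteq> {}" and Y: "finite Y" "card Y = card X"
    and uv: "\<And>x y. x \<in> X \<Longrightarrow> y \<in> Y \<Longrightarrow> M x y * (\<Sum>i<r. u x i * v y i) > 0"
    and M: "\<And>x y. x \<in> X \<Longrightarrow> y \<in> Y \<Longrightarrow> \<bar>M x y\<bar> \<ge> 1"
    and \<Lambda>: "\<And>a b. (\<Sum>x\<in>X. \<Sum>y\<in>Y. M x y * a x * b y) \<le> \<Lambda> * ((\<Sum>x\<in>X. (a x)\<^sup>2) + (\<Sum>y\<in>Y. (b y)\<^sup>2)) / 2"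
  shows "\<exists>C. \<forall>\<beta>. 0 < \<beta> \<and> \<beta> \<le> 1 \<longrightarrow> real (card X) / real r \<le> \<Lambda> + \<beta> * C"
proof -
  define N where "N = real (card X)"
  have N: "N > 0" using X by (simp add: N_def card_gt_0_iff)
  have Yne: "Y \<noteq> {}" using X Y by auto
  have ip0: "(\<Sum>i<r. u x i * v y i) \<noteq> 0" if "x \<in> X" "y \<in> Y" for x y using uv[OF that] by auto
  have r: "r > 0" using ip0 X Yne by (cases r) auto
  have u: "sq_norm r (u x) > 0" if "x \<in> X" for x
  proof -
    obtain y where "y \<in> Y" using Yne by auto
    then have "\<exists>i<r. u x i \<noteq> 0" using ip0[OF that, of y] by (auto intro: ccontr sum.neutral)
    then obtain i where i: "i < r" "u x i \<noteq> 0" by auto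
    then have "0 < (u x i)\<^sup>2" by simp
    also have "\<dots> \<le> sq_norm r (u x)" using i(1) by (rule component_le_sq_norm)
    finally show ?thesis .
  qed
  define \<Phi> where "\<Phi> = (\<Sum>x\<in>X. ln (sq_norm r (u x)))"
  \<comment> \<open>Comparison with the identity bounds the mean of the logarithms by
    \<open>(\<Phi> + real r) / N\<close> whenever \<open>\<beta> \<le> 1\<close>, so some image has
    squared norm at most \<open>L\<close>.\<close>
  define L where "L = exp ((\<Phi> + real r) / N)"
  \<comment> \<open>The \<open>x\<close> with small image may vary with \<open>\<beta>\<close>;
    summing over all \<open>x\<close> and \<open>y\<close> gives one constant that serves for
    each.\<close>
  define C where "C = (\<Sum>y\<in>Y. \<Sum>x\<in>X. sq_norm r (v y) * L / (\<Sum>i<r. u x i * v y i)\<^sup>2)"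
  show ?thesis
  proof (intro exI[of _ C] allI impI)
    fix \<beta> :: real assume \<beta>: "0 < \<beta> \<and> \<beta> \<le> 1"
    obtain A where A: "unimod_tri r A" "\<And>B. unimod_tri r B \<Longrightarrow> potential r \<beta> X u A \<le> potential r \<beta> X u B"
      by (rule potential_attains_min[where u = u and X = X and \<beta> = \<beta>, OF r _ X(1)]) (use u \<beta> in blast)+
    define p where "p = (\<lambda>x. tri_action r A (u x))"
    have p: "sq_norm r (p x) > 0" if "x \<in> X" for x
      unfolding p_def by (rule sq_norm_tri_action_pos[OF A(1) u[OF that]])
    have "\<exists>w. \<forall>l<r. (\<Sum>i<r. A (i, l) * w i) = v y l" for y
      using A(1) by (intro triangular_transpose_solve) (auto simp: unimod_tri_def)
    then obtain w where w: "\<And>y l. l < r \<Longrightarrow> (\<Sum>i<r. A (i, l) * w y i) = v y l" by metis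
    have ip: "(\<Sum>i<r. p x i * w y i) = (\<Sum>i<r. u x i * v y i)" for x y
    proof -
      have "(\<Sum>i<r. p x i * w y i) = (\<Sum>i<r. \<Sum>l<r. u x l * (A (i, l) * w y i))"
        by (simp add: p_def tri_action_def sum_distrib_right sum_distrib_left mult_ac)
      also have "\<dots> = (\<Sum>l<r. \<Sum>i<r. u x l * (A (i, l) * w y i))" by (rule sum.swap)
      also have "\<dots> = (\<Sum>l<r. u x l * v y l)" by (simp add: sum_distrib_left[symmetric] w)
      finally show ?thesis .
    qed
    have cs: "(\<Sum>i<r. u x i * v y i)\<^sup>2 \<le> sq_norm r (p x) * sq_norm r (w y)" for x y
      unfolding ip[symmetric] sq_norm_def by (rule Cauchy_Schwarz_ineq_sum)
    have wpos: "sq_norm r (w y) > 0" if "y \<in> Y" for y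
    proof -
      obtain x where x: "x \<in> X" using X by auto
      have "0 < (\<Sum>i<r. u x i * v y i)\<^sup>2" using ip0[OF x that] by simp
      also note cs[of x y]
      finally show ?thesis using p[OF x] by (simp add: zero_less_mult_iff)
    qed
    have "\<exists>x\<in>X. sq_norm r (p x) \<le> L"
    proof (rule ccontr)
      assume "\<not> ?thesis"
      then have "ln (sq_norm r (p x)) > ln L" if "x \<in> X" for x
        using that by (subst ln_less_cancel_iff) (auto simp: L_def p)
      then have "(\<Sum>x\<in>X. ln L) < (\<Sum>x\<in>X. ln (sq_norm r (p x)))"
        using X by (intro sum_strict_mono) auto
      also have "(\<Sum>x\<in>X. ln L) = \<Phi> + real r" using N by (simp add: L_def N_def)
      also have "(\<Sum>x\<in>X. ln (sq_norm r (p x))) \<le> potential r \<beta> X u A"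
        using \<beta> frob_nonneg[of r A] by (simp add: potential_def p_def)
      also have "\<dots> \<le> potential r \<beta> X u (\<lambda>(i, l). if i = l then 1 else 0)"
        by (intro A(2)) (auto simp: unimod_tri_def)
      also have "\<dots> = \<Phi> + \<beta> * real r"
      proof -
        have "sq_norm r (tri_action r (\<lambda>(i, l). if i = l then 1 else 0) (u x)) = sq_norm r (u x)" for x
          by (simp add: sq_norm_def tri_action_def if_distrib[of "\<lambda>c. c * _"] cong: if_cong)
        moreover have "frob r (\<lambda>(i, l). if i = l then 1 else 0) = real r"
          by (simp add: frob_def if_distrib[of "\<lambda>c. c\<^sup>2"] cong: if_cong)
        ultimately show ?thesis by (simp add: potential_def \<Phi>_def)
      qed
      also have "\<dots> \<le> \<Phi> + real r" using \<beta> by (simp add: mult_left_le_one_le)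
      finally show False by simp
    qed
    then obtain x0 where x0: "x0 \<in> X" "sq_norm r (p x0) \<le> L" by auto
    have vw: "sq_norm r (v y) / sq_norm r (w y) \<le> C" if y: "y \<in> Y" for y
    proof -
      have ip2: "(\<Sum>i<r. u x0 i * v y i)\<^sup>2 > 0" using ip0[OF x0(1) y] by simp
      have "(\<Sum>i<r. u x0 i * v y i)\<^sup>2 \<le> L * sq_norm r (w y)"
        using cs[of x0 y] mult_right_mono[OF x0(2), of "sq_norm r (w y)"] wpos[OF y] by linarith
      then have "1 / sq_norm r (w y) \<le> L / (\<Sum>i<r. u x0 i * v y i)\<^sup>2"
        using ip2 wpos[OF y] by (simp add: divide_simps mult.commute)
      from mult_left_mono[OF this sq_norm_nonneg[of r "v y"]]
      have "sq_norm r (v y) / sq_norm r (w y) \<le> sq_norm r (v y) * L / (\<Sum>i<r. u x0 i * v y i)\<^sup>2" by simp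
      also have "\<dots> \<le> (\<Sum>x\<in>X. sq_norm r (v y) * L / (\<Sum>i<r. u x i * v y i)\<^sup>2)"
        using x0 X by (intro member_le_sum[where f = "\<lambda>x. sq_norm r (v y) * L / (\<Sum>i<r. u x i * v y i)\<^sup>2"])
          (auto simp: L_def sq_norm_nonneg)
      also have "\<dots> \<le> C" unfolding C_def
        using y Y by (intro member_le_sum[where f = "\<lambda>y. \<Sum>x\<in>X. sq_norm r (v y) * L / (\<Sum>i<r. u x i * v y i)\<^sup>2"])
          (auto simp: L_def sq_norm_nonneg intro!: sum_nonneg)
      finally show ?thesis .
    qed
    define p' where "p' = (\<lambda>x i. p x i / sqrt (sq_norm r (p x)))"
    define w' where "w' = (\<lambda>y i. w y i / sqrt (sq_norm r (w y)))"
    define c where "c = (\<lambda>x y. \<Sum>i<r. p' x i * w' y i)"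
    have c: "c x y = (\<Sum>i<r. u x i * v y i) / (sqrt (sq_norm r (p x)) * sqrt (sq_norm r (w y)))" for x y
      by (simp add: c_def p'_def w'_def ip[symmetric] sum_divide_distrib)
    have c2: "(c x y)\<^sup>2 = (\<Sum>i<r. p x i * w y i)\<^sup>2 / sq_norm r (p x) / sq_norm r (w y)" for x y
      by (simp add: c ip power_divide power_mult_distrib sq_norm_nonneg)
    \<comment> \<open>Cauchy-Schwarz gives
      \<open>\<bar>c x y\<bar> \<le> 1 \<le> \<bar>M x y\<bar>\<close>, and sign agreement turns
      \<open>\<bar>M x y\<bar> * \<bar>c x y\<bar>\<close> into
      \<open>M x y * c x y\<close>.\<close>
    have Mc: "(c x y)\<^sup>2 \<le> M x y * c x y" if "x \<in> X" "y \<in> Y" for x y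
    proof -
      have "(c x y)\<^sup>2 \<le> 1" using cs[of x y] p[OF that(1)] wpos[OF that(2)]
        by (simp add: c2 ip divide_simps mult.commute)
      then have "\<bar>c x y\<bar> \<le> 1" by (simp add: abs_square_le_1)
      then have "\<bar>c x y\<bar> * \<bar>c x y\<bar> \<le> 1 * \<bar>c x y\<bar>" by (intro mult_right_mono) auto
      also have "\<dots> \<le> \<bar>M x y\<bar> * \<bar>c x y\<bar>" using M[OF that] by (intro mult_right_mono) auto
      also have "\<dots> = M x y * c x y"
      proof -
        have "M x y * c x y = M x y * (\<Sum>i<r. u x i * v y i) / (sqrt (sq_norm r (p x)) * sqrt (sq_norm r (w y)))"
          by (simp add: c)
        also have "\<dots> \<ge> 0" using uv[OF that] p[OF that(1)] wpos[OF that(2)] by simp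
        finally show ?thesis by (metis abs_mult abs_of_nonneg)
      qed
      finally show ?thesis by (simp add: power2_eq_square)
    qed
    \<comment> \<open>Isotropy tested on \<open>w y\<close>; the penalty term becomes the norm of
      the original \<open>v y\<close> because \<open>w y\<close> solves the transposed
      system.\<close>
    have col: "N / real r - \<beta> * C \<le> (\<Sum>x\<in>X. (c x y)\<^sup>2)" if y: "y \<in> Y" for y
    proof -
      have "N / real r * sq_norm r (w y) \<le> (\<Sum>x\<in>X. (\<Sum>i<r. p x i * w y i)\<^sup>2 / sq_norm r (p x))
          + \<beta> * (\<Sum>l<r. (\<Sum>i<r. A (i, l) * w y i)\<^sup>2)"
        unfolding N_def p_def using \<beta> by (intro minimizer_isotropic r X(1) u A) auto
      also have "(\<Sum>l<r. (\<Sum>i<r. A (i, l) * w y i)\<^sup>2) = sq_norm r (v y)"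
        by (simp add: w sq_norm_def)
      finally have "N / real r * sq_norm r (w y) / sq_norm r (w y) \<le>
         ((\<Sum>x\<in>X. (\<Sum>i<r. p x i * w y i)\<^sup>2 / sq_norm r (p x)) + \<beta> * sq_norm r (v y)) / sq_norm r (w y)"
        using wpos[OF y] by (intro divide_right_mono) auto
      then have "N / real r \<le> (\<Sum>x\<in>X. (c x y)\<^sup>2) + \<beta> * (sq_norm r (v y) / sq_norm r (w y))"
        using wpos[OF y] by (simp add: c2 add_divide_distrib sum_divide_distrib)
      also have "\<dots> \<le> (\<Sum>x\<in>X. (c x y)\<^sup>2) + \<beta> * C"
        using vw[OF y] \<beta> by (intro add_left_mono mult_left_mono) auto
      finally show ?thesis by simp
    qed
    have unit_p: "(\<Sum>i<r. (p' x i)\<^sup>2) = 1" if "x \<in> X" for x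
      using p[OF that] by (simp add: p'_def power_divide sq_norm_nonneg sum_divide_distrib[symmetric] sq_norm_def[symmetric])
    have unit_w: "(\<Sum>i<r. (w' y i)\<^sup>2) = 1" if "y \<in> Y" for y
      using wpos[OF that] by (simp add: w'_def power_divide sq_norm_nonneg sum_divide_distrib[symmetric] sq_norm_def[symmetric])
    have "N * (N / real r - \<beta> * C) = (\<Sum>y\<in>Y. N / real r - \<beta> * C)" by (simp add: N_def Y)
    also have "\<dots> \<le> (\<Sum>y\<in>Y. \<Sum>x\<in>X. M x y * c x y)"
      using col Mc by (intro sum_mono) (meson order.trans sum_mono)
    also have "\<dots> = (\<Sum>x\<in>X. \<Sum>y\<in>Y. \<Sum>i<r. M x y * p' x i * w' y i)"
      by (subst sum.swap) (simp add: c_def sum_distrib_left mult_ac)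
    also have "\<dots> = (\<Sum>x\<in>X. \<Sum>i<r. \<Sum>y\<in>Y. M x y * p' x i * w' y i)"
      by (intro sum.cong refl sum.swap)
    also have "\<dots> = (\<Sum>i<r. \<Sum>x\<in>X. \<Sum>y\<in>Y. M x y * p' x i * w' y i)" by (rule sum.swap)
    \<comment> \<open>The bilinear bound is used coordinate by coordinate; summed over
      \<open>i\<close>, the unit vectors contribute \<open>N\<close> on each side.\<close>
    also have "\<dots> \<le> (\<Sum>i<r. \<Lambda> * ((\<Sum>x\<in>X. (p' x i)\<^sup>2) + (\<Sum>y\<in>Y. (w' y i)\<^sup>2)) / 2)"
      by (intro sum_mono \<Lambda>)
    also have "\<dots> = \<Lambda> * ((\<Sum>i<r. \<Sum>x\<in>X. (p' x i)\<^sup>2) + (\<Sum>i<r. \<Sum>y\<in>Y. (w' y i)\<^sup>2)) / 2"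
      by (simp add: sum_distrib_left sum_divide_distrib sum.distrib add_divide_distrib distrib_left)
    also have "(\<Sum>i<r. \<Sum>x\<in>X. (p' x i)\<^sup>2) = N" by (subst sum.swap) (simp add: unit_p N_def)
    also have "(\<Sum>i<r. \<Sum>y\<in>Y. (w' y i)\<^sup>2) = N" by (subst sum.swap) (simp add: unit_w N_def Y)
    finally have "N * (N / real r - \<beta> * C) \<le> N * \<Lambda>" by (simp add: mult.commute[of N \<Lambda>])
    then show "real (card X) / real r \<le> \<Lambda> + \<beta> * C" using N by (simp add: N_def)
  qed
qed

text \<open>Let \<open>\<beta>\<close> tend to 0 in the perturbed bound, whose constant is
  fixed.\<close>

lemma forster_bound:
  fixes u :: "'x \<Rightarrow> nat \<Rightarrow> real" and v :: "'y \<Rightarrow> nat \<Rightarrow> real" and M :: "'x \<Rightarrow> 'y \<Rightarrow> real"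
  assumes X: "finite X" "X \<noteq> {}" and Y: "finite Y" "card Y = card X"
    and uv: "\<And>x y. x \<in> X \<Longrightarrow> y \<in> Y \<Longrightarrow> M x y * (\<Sum>i<r. u x i * v y i) > 0"
    and M: "\<And>x y. x \<in> X \<Longrightarrow> y \<in> Y \<Longrightarrow> \<bar>M x y\<bar> \<ge> 1"
    and \<Lambda>: "\<And>a b. (\<Sum>x\<in>X. \<Sum>y\<in>Y. M x y * a x * b y) \<le> \<Lambda> * ((\<Sum>x\<in>X. (a x)\<^sup>2) + (\<Sum>y\<in>Y. (b y)\<^sup>2)) / 2"
  shows "real (card X) \<le> \<Lambda> * real r"
proof -
  obtain C where C: "\<And>\<beta>. 0 < \<beta> \<Longrightarrow> \<beta> \<le> 1 \<Longrightarrow> real (card X) / real r \<le> \<Lambda> + \<beta> * C"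
    using forster_perturbed[OF assms] by blast
  obtain x y where xy: "x \<in> X" "y \<in> Y" using X Y by (metis card.empty card_eq_0_iff ex_in_conv)
  have r: "r > 0" using uv[OF xy] by (cases r) auto
  have "((\<lambda>\<beta>. \<Lambda> + \<beta> * C) \<longlongrightarrow> \<Lambda> + 0 * C) (at_right 0)" by (intro tendsto_intros)
  moreover have "eventually (\<lambda>\<beta>. real (card X) / real r \<le> \<Lambda> + \<beta> * C) (at_right 0)"
    using C by (auto simp: eventually_at_right_field intro!: exI[of _ 1])
  ultimately have "real (card X) / real r \<le> \<Lambda> + 0 * C"
    by (rule tendsto_lowerbound) simp
  then show ?thesis using r by (simp add: divide_simps)
qed

section \<open>From protocols to sign rank\<close>

text \<open>Factorisations add by concatenation of coordinates; the bound \<open>2 * c\<close>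
  matches one more bit of communication.\<close>

lemma sum_rank_one_append:
  fixes f1 f2 :: "'x \<Rightarrow> 'y \<Rightarrow> real"
  assumes 1: "L1 \<le> c" "\<And>x y. f1 x y = (\<Sum>i<L1. a1 x i * b1 y i)"
    and 2: "L2 \<le> c" "\<And>x y. f2 x y = (\<Sum>i<L2. a2 x i * b2 y i)"
  shows "\<exists>L (a :: 'x \<Rightarrow> nat \<Rightarrow> real) b. L \<le> 2 * c \<and> (\<forall>x y. f1 x y + f2 x y = (\<Sum>i<L. a x i * b y i))"
proof -
  have split: "(\<Sum>i<L1 + n. (if i < L1 then g i else h (i - L1))) = (\<Sum>i<L1. g i) + (\<Sum>i<n. h i)"
    for n and g h :: "nat \<Rightarrow> real"
    by (induction n) auto
  have "(\<Sum>i<L1 + L2. (if i < L1 then a1 x i else a2 x (i - L1)) * (if i < L1 then b1 y i else b2 y (i - L1)))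
      = (\<Sum>i<L1 + L2. if i < L1 then a1 x i * b1 y i else a2 x (i - L1) * b2 y (i - L1))" for x y
    by (intro sum.cong) auto
  then have "f1 x y + f2 x y = (\<Sum>i<L1 + L2. (if i < L1 then a1 x i else a2 x (i - L1))
      * (if i < L1 then b1 y i else b2 y (i - L1)))" for x y
    using split[of "\<lambda>i. a1 x i * b1 y i" "\<lambda>i. a2 x i * b2 y i" L2] by (simp add: 1(2) 2(2))
  moreover have "L1 + L2 \<le> 2 * c" using 1(1) 2(1) by simp
  ultimately show ?thesis by (intro exI[of _ "L1 + L2"]
    exI[of _ "\<lambda>x i. if i < L1 then a1 x i else a2 x (i - L1)"]
    exI[of _ "\<lambda>y i. if i < L1 then b1 y i else b2 y (i - L1)"]) blast
qed

lemma prob_pair_Times: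
  "measure_pmf.prob (pair_pmf P Q) (S \<times> T) = measure_pmf.prob P S * measure_pmf.prob Q T"
proof -
  have "emeasure (pair_pmf P Q) (S \<times> T) = (\<integral>\<^sup>+p. indicator (S \<times> T) p \<partial>pair_pmf P Q)" by simp
  also have "\<dots> = (\<integral>\<^sup>+r. \<integral>\<^sup>+s. indicator S r * indicator T s \<partial>Q \<partial>P)"
    by (subst nn_integral_pair_pmf') (simp add: indicator_times)
  also have "\<dots> = emeasure P S * emeasure Q T"
    by (simp add: nn_integral_cmult nn_integral_multc)
  finally show ?thesis by (simp add: measure_def enn2real_mult)
qed

text \<open>The acceptance probabilities split over the leaves, and at each leaf the set of random strings
  reaching it is a rectangle.\<close>

lemma protocol_output_prob_low_rank:
  fixes p :: "('x, 'y, int) protocol" and P Q :: "bool list pmf"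
  shows "\<exists>L (a :: 'x \<Rightarrow> nat \<Rightarrow> real) b. L \<le> 2 ^ cost p \<and> (\<forall>x y.
    measure_pmf.prob (pair_pmf P Q) {(r, s). r \<in> S x \<and> s \<in> T y \<and> run p x y r s = 1}
    - measure_pmf.prob (pair_pmf P Q) {(r, s). r \<in> S x \<and> s \<in> T y \<and> run p x y r s = - 1} = (\<Sum>i<L. a x i * b y i))"
proof (induction p arbitrary: S T)
  case (Output v)
  have "measure_pmf.prob (pair_pmf P Q) {(r, s). r \<in> S x \<and> s \<in> T y \<and> run (Output v) x y r s = z}
     = of_bool (v = z) * measure_pmf.prob P (S x) * measure_pmf.prob Q (T y)" for x y z
  proof -
    have "{(r, s). r \<in> S x \<and> s \<in> T y \<and> run (Output v) x y r s = z} = (if v = z then S x \<times> T y else {})"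
      by auto
    then show ?thesis by (simp add: prob_pair_Times)
  qed
  then show ?case
    \<comment> \<open>A leaf has rank one; an output other than 1 and -1 gets the coefficient
      0.\<close>
    by (intro exI[of _ 1] exI[of _ "\<lambda>x i. (of_bool (v = 1) - of_bool (v = - 1)) * measure_pmf.prob P (S x)"]
        exI[of _ "\<lambda>y i. measure_pmf.prob Q (T y)"]) (auto simp: left_diff_distrib)
next
  case (Alice f p q)
  let ?pr = "measure_pmf.prob (pair_pmf P Q)"
  let ?n = "\<lambda>x y z. ?pr {(r, s). r \<in> S x \<inter> {r. \<not> f x r} \<and> s \<in> T y \<and> run p x y r s = z}"
  let ?y = "\<lambda>x y z. ?pr {(r, s). r \<in> S x \<inter> {r. f x r} \<and> s \<in> T y \<and> run q x y r s = z}"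
  let ?c = "2 ^ max (cost p) (cost q) :: nat"
  obtain L1 and a1 :: "'x \<Rightarrow> nat \<Rightarrow> real" and b1 where 1: "L1 \<le> 2 ^ cost p" "\<And>x y.
    ?n x y 1
    - ?n x y (- 1)
    = (\<Sum>i<L1. a1 x i * b1 y i)"
    using Alice(1)[of "\<lambda>x. S x \<inter> {r. \<not> f x r}" T] by blast
  obtain L2 and a2 :: "'x \<Rightarrow> nat \<Rightarrow> real" and b2 where 2: "L2 \<le> 2 ^ cost q" "\<And>x y.
    ?y x y 1
    - ?y x y (- 1)
    = (\<Sum>i<L2. a2 x i * b2 y i)"
    using Alice(2)[of "\<lambda>x. S x \<inter> {r. f x r}" T] by blast
  have split: "measure_pmf.prob (pair_pmf P Q) {(r, s). r \<in> S x \<and> s \<in> T y \<and> run (Alice f p q) x y r s = z}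
    = ?n x y z
    + ?y x y z" for x y z
    by (subst measure_pmf.finite_measure_Union[symmetric]) (auto intro!: arg_cong[where f = "measure_pmf.prob _"])
  have le: "L1 \<le> ?c" "L2 \<le> ?c"
    using 1(1) 2(1) by (auto elim!: order.trans intro!: power_increasing)
  have eq: "?pr {(r, s). r \<in> S x \<and> s \<in> T y \<and> run (Alice f p q) x y r s = 1}
      - ?pr {(r, s). r \<in> S x \<and> s \<in> T y \<and> run (Alice f p q) x y r s = - 1}
    = (?n x y 1 - ?n x y (- 1)) + (?y x y 1 - ?y x y (- 1))" for x y
    unfolding split by (rule add_diff_add)
  have "\<exists>L (a :: 'x \<Rightarrow> nat \<Rightarrow> real) b. L \<le> 2 * ?c \<and> (\<forall>x y.
      (?n x y 1 - ?n x y (- 1)) + (?y x y 1 - ?y x y (- 1)) = (\<Sum>i<L. a x i * b y i))"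
    by (rule sum_rank_one_append[OF le(1) 1(2) le(2) 2(2)])
  then show ?case unfolding eq cost.simps power_add power_one_right .
next
  case (Bob f p q)
  let ?pr = "measure_pmf.prob (pair_pmf P Q)"
  let ?n = "\<lambda>x y z. ?pr {(r, s). r \<in> S x \<and> s \<in> T y \<inter> {s. \<not> f y s} \<and> run p x y r s = z}"
  let ?y = "\<lambda>x y z. ?pr {(r, s). r \<in> S x \<and> s \<in> T y \<inter> {s. f y s} \<and> run q x y r s = z}"
  let ?c = "2 ^ max (cost p) (cost q) :: nat"
  obtain L1 and a1 :: "'x \<Rightarrow> nat \<Rightarrow> real" and b1 where 1: "L1 \<le> 2 ^ cost p" "\<And>x y.
    ?n x y 1
    - ?n x y (- 1)
    = (\<Sum>i<L1. a1 x i * b1 y i)"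
    using Bob(1)[of S "\<lambda>y. T y \<inter> {s. \<not> f y s}"] by blast
  obtain L2 and a2 :: "'x \<Rightarrow> nat \<Rightarrow> real" and b2 where 2: "L2 \<le> 2 ^ cost q" "\<And>x y.
    ?y x y 1
    - ?y x y (- 1)
    = (\<Sum>i<L2. a2 x i * b2 y i)"
    using Bob(2)[of S "\<lambda>y. T y \<inter> {s. f y s}"] by blast
  have split: "measure_pmf.prob (pair_pmf P Q) {(r, s). r \<in> S x \<and> s \<in> T y \<and> run (Bob f p q) x y r s = z}
    = ?n x y z
    + ?y x y z" for x y z
    by (subst measure_pmf.finite_measure_Union[symmetric]) (auto intro!: arg_cong[where f = "measure_pmf.prob _"])
  have le: "L1 \<le> ?c" "L2 \<le> ?c"
    using 1(1) 2(1) by (auto elim!: order.trans intro!: power_increasing)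
  have eq: "?pr {(r, s). r \<in> S x \<and> s \<in> T y \<and> run (Bob f p q) x y r s = 1}
      - ?pr {(r, s). r \<in> S x \<and> s \<in> T y \<and> run (Bob f p q) x y r s = - 1}
    = (?n x y 1 - ?n x y (- 1)) + (?y x y 1 - ?y x y (- 1))" for x y
    unfolding split by (rule add_diff_add)
  have "\<exists>L (a :: 'x \<Rightarrow> nat \<Rightarrow> real) b. L \<le> 2 * ?c \<and> (\<forall>x y.
      (?n x y 1 - ?n x y (- 1)) + (?y x y 1 - ?y x y (- 1)) = (\<Sum>i<L. a x i * b y i))"
    by (rule sum_rank_one_append[OF le(1) 1(2) le(2) 2(2)])
  then show ?case unfolding eq cost.simps power_add power_one_right .
qed

text \<open>The correct value has probability above 1/2 and the two values together at most 1, so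
  the difference of their probabilities carries the sign of \<open>G\<close>.\<close>

lemma protocol_sign_rank:
  fixes G :: "'x \<Rightarrow> 'y \<Rightarrow> int"
  assumes p: "computes_with_advantage X Y G \<epsilon> p P Q" and e: "\<epsilon> > 0"
    and G: "\<And>x y. x \<in> X \<Longrightarrow> y \<in> Y \<Longrightarrow> G x y \<in> {-1, 1}"
  obtains L and a :: "'x \<Rightarrow> nat \<Rightarrow> real" and b where "L \<le> 2 ^ cost p"
    "\<And>x y. x \<in> X \<Longrightarrow> y \<in> Y \<Longrightarrow> real_of_int (G x y) * (\<Sum>i<L. a x i * b y i) > 0"
proof -
  let ?pr = "\<lambda>x y z. measure_pmf.prob (pair_pmf P Q) {(r, s). run p x y r s = z}"
  obtain L and a :: "'x \<Rightarrow> nat \<Rightarrow> real" and b where L: "L \<le> 2 ^ cost p"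
    "\<And>x y. ?pr x y 1 - ?pr x y (- 1) = (\<Sum>i<L. a x i * b y i)"
    using protocol_output_prob_low_rank[of p P Q "\<lambda>_. UNIV" "\<lambda>_. UNIV"] by auto
  have "real_of_int (G x y) * (\<Sum>i<L. a x i * b y i) > 0" if xy: "x \<in> X" "y \<in> Y" for x y
  proof -
    have "?pr x y (G x y) \<ge> 1 / 2 + \<epsilon>" using p xy by (simp add: computes_with_advantage_def)
    moreover have "?pr x y 1 + ?pr x y (- 1) \<le> 1"
    proof -
      have "?pr x y 1 + ?pr x y (- 1) = measure_pmf.prob (pair_pmf P Q) ({(r, s). run p x y r s = 1} \<union> {(r, s). run p x y r s = - 1})"
        by (intro measure_pmf.finite_measure_Union[symmetric]) auto
      then show ?thesis by simp
    qed
    ultimately show ?thesis using G[OF xy] e L(2)[of x y] by auto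
  qed
  then show ?thesis using that L(1) by blast
qed

section \<open>XOR matrices\<close>

lemma weight_Nil [simp]: "weight [] = 0"
  by (simp add: weight_def)

lemma weight_Cons [simp]: "weight (b # x) = of_bool b + weight x"
  unfolding weight_def list.size(4) add_Suc_right add_0_right sum.lessThan_Suc_shift by simp

lemma weight_append [simp]: "weight (x @ y) = weight x + weight y"
  by (induction x) auto

lemma weight_replicate [simp]: "weight (replicate k b) = (if b then k else 0)"
  by (induction k) auto

lemma odd_weight_xor:
  "length x = length y \<Longrightarrow> odd (weight (map2 (\<noteq>) x y)) \<longleftrightarrow> odd (weight x) \<noteq> odd (weight y)"
  by (induction x y rule: list_induct2) auto

lemma cube_Suc: "cube (Suc n) = (#) False ` cube n \<union> (#) True ` cube n"
  by (auto simp: cube_def length_Suc_conv image_iff)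

lemma cube_0: "cube 0 = {[]}"
  by (auto simp: cube_def)

lemma finite_cube [simp]: "finite (cube n)"
  by (induction n) (auto simp: cube_0 cube_Suc)

lemma sum_cube_Suc: "sum f (cube (Suc n)) = (\<Sum>x\<in>cube n. f (False # x) + f (True # x))"
  unfolding cube_Suc by (subst sum.union_disjoint) (auto simp: sum.reindex inj_on_def sum.distrib)

lemma card_cube: "card (cube n) = 2 ^ n"
  using sum_cube_Suc[of "\<lambda>_. 1::nat"] by (induction n) (auto simp: cube_0)

text \<open>The matrix is the tensor power of \<open>[[1, z], [z, 1]]\<close>, whose eigenvalues are \<open>1 + z\<close> and \<open>1 - z\<close>.\<close>

lemma xor_power_form_bound:
  fixes z :: complex
  assumes "norm (1 + z) \<le> \<mu>" "norm (1 - z) \<le> \<mu>"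
  shows "norm (\<Sum>x\<in>cube n. \<Sum>y\<in>cube n. z ^ weight (map2 (\<noteq>) x y) * of_real (a x) * of_real (b y))
    \<le> \<mu> ^ n * ((\<Sum>x\<in>cube n. (a x)\<^sup>2) + (\<Sum>y\<in>cube n. (b y)\<^sup>2)) / 2"
proof (induction n arbitrary: a b)
  case 0
  have "\<bar>a [] * b []\<bar> \<le> ((a [])\<^sup>2 + (b [])\<^sup>2) / 2"
    using sum_squares_bound[of "\<bar>a []\<bar>" "\<bar>b []\<bar>"] by (simp add: abs_mult)
  then show ?case by (simp add: cube_0 norm_mult abs_mult)
next
  case (Suc n)
  define S where "S = (\<lambda>a b. \<Sum>x\<in>cube n. \<Sum>y\<in>cube n. z ^ weight (map2 (\<noteq>) x y) * of_real (a x) * of_real (b y))"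
  define Q where "Q = (\<lambda>a. \<Sum>x\<in>cube n. (a x :: real)\<^sup>2)"
  \<comment> \<open>Sums and differences over the first bit diagonalise its 2 by 2 block; by the
    parallelogram identity their squares add to twice those of \<open>a\<close> and
    \<open>b\<close>.\<close>
  let ?ap = "\<lambda>x. a (False # x) + a (True # x)" and ?am = "\<lambda>x. a (False # x) - a (True # x)"
  let ?bp = "\<lambda>x. b (False # x) + b (True # x)" and ?bm = "\<lambda>x. b (False # x) - b (True # x)"
  have half: "norm c / 2 * q \<le> \<mu> / 2 * r" if "norm c \<le> \<mu>" "q \<le> r" "0 \<le> q" for c :: complex and q r
    by (rule mult_mono) (use that order.trans[OF norm_ge_zero that(1)] in simp_all)
  have "(\<Sum>x\<in>cube (Suc n). \<Sum>y\<in>cube (Suc n). z ^ weight (map2 (\<noteq>) x y) * of_real (a x) * of_real (b y))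
    = (\<Sum>x\<in>cube n. \<Sum>y\<in>cube n.
        (1 + z) / 2 * (z ^ weight (map2 (\<noteq>) x y) * of_real (?ap x) * of_real (?bp y))
      + (1 - z) / 2 * (z ^ weight (map2 (\<noteq>) x y) * of_real (?am x) * of_real (?bm y)))"
    unfolding sum_cube_Suc sum.distrib[symmetric] by (intro sum.cong refl) (simp add: field_simps)
  also have "\<dots> = (1 + z) / 2 * S ?ap ?bp + (1 - z) / 2 * S ?am ?bm"
    by (simp only: S_def sum.distrib sum_distrib_left)
  finally have eq: "(\<Sum>x\<in>cube (Suc n). \<Sum>y\<in>cube (Suc n). z ^ weight (map2 (\<noteq>) x y) * of_real (a x) * of_real (b y))
    = (1 + z) / 2 * S ?ap ?bp + (1 - z) / 2 * S ?am ?bm" .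
  have "norm ((1 + z) / 2 * S ?ap ?bp + (1 - z) / 2 * S ?am ?bm) \<le> norm (1 + z) / 2 * norm (S ?ap ?bp) + norm (1 - z) / 2 * norm (S ?am ?bm)"
    by (rule order.trans[OF norm_triangle_ineq]) (simp add: norm_mult norm_divide)
  also have "\<dots> \<le> \<mu> / 2 * (\<mu> ^ n * (Q ?ap + Q ?bp) / 2) + \<mu> / 2 * (\<mu> ^ n * (Q ?am + Q ?bm) / 2)"
    using half[OF assms(1) Suc.IH[of ?ap ?bp] norm_ge_zero] half[OF assms(2) Suc.IH[of ?am ?bm] norm_ge_zero]
    unfolding S_def Q_def by (rule add_mono)
  also have "\<dots> = \<mu> ^ Suc n * ((Q ?ap + Q ?am) + (Q ?bp + Q ?bm)) / 4"
    by (simp add: field_simps)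
  also have "Q ?ap + Q ?am = 2 * (\<Sum>x\<in>cube (Suc n). (a x)\<^sup>2)"
    unfolding Q_def sum_cube_Suc sum.distrib[symmetric] sum_distrib_left
    by (intro sum.cong) (auto simp: power2_eq_square algebra_simps)
  also have "Q ?bp + Q ?bm = 2 * (\<Sum>x\<in>cube (Suc n). (b x)\<^sup>2)"
    unfolding Q_def sum_cube_Suc sum.distrib[symmetric] sum_distrib_left
    by (intro sum.cong) (auto simp: power2_eq_square algebra_simps)
  finally show ?case unfolding eq by (simp add: field_simps)
qed

text \<open>\<open>f\<close> and \<open>g\<close> embed a smaller XOR problem into the inputs of the
  protocol. \<open>H\<close> need only have the sign of the function and absolute value at least 1,
  which leaves room to choose it with small spectral norm.\<close>

lemma xor_protocol_lower_bound:
  fixes G :: "'x \<Rightarrow> 'y \<Rightarrow> int" and H :: "nat \<Rightarrow> real"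
  assumes p: "computes_with_advantage X Y G \<epsilon> p P Q" "\<epsilon> > 0"
    and G: "\<And>x y. G x y \<in> {-1, 1}"
    and enc: "\<And>x. x \<in> cube n \<Longrightarrow> f x \<in> X" "\<And>y. y \<in> cube n \<Longrightarrow> g y \<in> Y"
    and H: "\<And>x y. x \<in> cube n \<Longrightarrow> y \<in> cube n \<Longrightarrow> G (f x) (g y) * H (weight (map2 (\<noteq>) x y)) \<ge> 1"
    and \<Lambda>: "\<And>a b. (\<Sum>x\<in>cube n. \<Sum>y\<in>cube n. H (weight (map2 (\<noteq>) x y)) * a x * b y)
        \<le> \<Lambda> * ((\<Sum>x\<in>cube n. (a x)\<^sup>2) + (\<Sum>y\<in>cube n. (b y)\<^sup>2)) / 2"
  shows "2 ^ n \<le> \<Lambda> * 2 ^ cost p"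
proof -
  obtain L and u :: "'x \<Rightarrow> nat \<Rightarrow> real" and v where L: "L \<le> 2 ^ cost p"
    "\<And>x y. x \<in> X \<Longrightarrow> y \<in> Y \<Longrightarrow> real_of_int (G x y) * (\<Sum>i<L. u x i * v y i) > 0"
    using protocol_sign_rank[OF p] G by blast
  have ne: "cube n \<noteq> {}" using card_cube[of n] by auto
  have "real (card (cube n)) \<le> \<Lambda> * real L"
  proof (rule forster_bound[where u = "\<lambda>x. u (f x)" and v = "\<lambda>y. v (g y)" and M = "\<lambda>x y. H (weight (map2 (\<noteq>) x y))"])
    fix x y assume xy: "x \<in> cube n" "y \<in> cube n"
    show "0 < H (weight (map2 (\<noteq>) x y)) * (\<Sum>i<L. u (f x) i * v (g y) i)"
      using L(2)[OF enc(1)[OF xy(1)] enc(2)[OF xy(2)]] H[OF xy] G[of "f x" "g y"]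
      by (auto simp: zero_less_mult_iff)
    show "1 \<le> \<bar>H (weight (map2 (\<noteq>) x y))\<bar>" using H[OF xy] G[of "f x" "g y"] by auto
  qed (use ne \<Lambda> in auto)
  then have le: "2 ^ n \<le> \<Lambda> * real L" by (simp add: card_cube)
  also have "\<dots> \<le> \<Lambda> * 2 ^ cost p"
  proof (rule mult_left_mono)
    show "real L \<le> 2 ^ cost p" using L(1) by (metis of_nat_le_iff of_nat_numeral of_nat_power)
    \<comment> \<open>Nonnegativity of \<open>\<Lambda>\<close>, needed for enlarging
      \<open>L\<close>, follows from the bound just obtained.\<close>
    have "0 < \<Lambda> * real L" using le by (meson less_le_trans zero_less_numeral zero_less_power)
    then show "0 \<le> \<Lambda>" by (simp add: zero_less_mult_iff)
  qed
  finally show ?thesis .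
qed

section \<open>Trigonometric estimates and characters of odd period\<close>

text \<open>The derivative of \<open>sin t - t / 2\<close> is nonnegative as long as the cosine is
  at least 1/2.\<close>

lemma half_le_sin:
  fixes t :: real assumes "0 \<le> t" "t \<le> pi / 3"
  shows "t / 2 \<le> sin t"
proof -
  have "sin 0 - 0 / 2 \<le> sin t - t / 2"
  proof (rule DERIV_nonneg_imp_nondecreasing[OF assms(1)])
    fix x assume x: "0 \<le> x" "x \<le> t"
    have "cos (pi / 3) \<le> cos x" using x assms pi_gt_zero by (intro cos_monotone_0_pi_le) linarith+
    then have "0 \<le> cos x - 1 / 2" by (simp add: cos_60)
    moreover have "((\<lambda>x. sin x - x / 2) has_real_derivative (cos x - 1 / 2)) (at x)"
      by (auto intro!: derivative_eq_intros)
    ultimately show "\<exists>y. ((\<lambda>x. sin x - x / 2) has_real_derivative y) (at x) \<and> 0 \<le> y" by blast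
  qed
  then show ?thesis by simp
qed

text \<open>Half-angle formula with \<open>sin (x / 2) \<ge> x / 4\<close>.\<close>

lemma cos_le_one_minus_square:
  fixes x :: real assumes "0 \<le> x" "x \<le> pi / 2"
  shows "cos x \<le> 1 - x\<^sup>2 / 8"
proof -
  have "(x / 2) / 2 \<le> sin (x / 2)" using assms pi_gt_zero by (intro half_le_sin) linarith+
  then have "(x / 4)\<^sup>2 \<le> (sin (x / 2))\<^sup>2" using assms by (intro power_mono) auto
  moreover have "cos x = 1 - 2 * (sin (x / 2))\<^sup>2" using cos_double_sin[of "x / 2"] by simp
  ultimately show ?thesis by (simp add: power2_eq_square)
qed

text \<open>The squared norms are \<open>2 + 2 * cos \<theta>\<close> and
  \<open>2 - 2 * cos \<theta>\<close>, at most
  \<open>4 - 2 * \<delta> \<le> 4 * exp (- \<delta> / 2)\<close>.\<close>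

lemma norm_one_pm_cis:
  assumes "\<bar>cos \<theta>\<bar> \<le> 1 - \<delta>"
  shows "norm (1 + cis \<theta>) \<le> 2 * exp (- \<delta> / 4)" "norm (1 - cis \<theta>) \<le> 2 * exp (- \<delta> / 4)"
proof -
  have e: "2 + 2 * \<bar>cos \<theta>\<bar> \<le> (2 * exp (- \<delta> / 4))\<^sup>2"
  proof -
    have "1 - \<delta> / 2 \<le> exp (- \<delta> / 2)" using exp_ge_add_one_self[of "- \<delta> / 2"] by simp
    moreover have "(2 * exp (- \<delta> / 4))\<^sup>2 = 4 * exp (- \<delta> / 2)"
      by (simp add: power_mult_distrib exp_double[symmetric])
    ultimately show ?thesis using assms by simp
  qed
  have "(norm (1 + cis \<theta>))\<^sup>2 = (1 + cos \<theta>)\<^sup>2 + (sin \<theta>)\<^sup>2"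
    by (simp add: cmod_power2)
  also have "\<dots> = 2 + 2 * cos \<theta>"
    using sin_cos_squared_add[of \<theta>] by (simp add: power2_eq_square algebra_simps)
  finally have "(norm (1 + cis \<theta>))\<^sup>2 = 2 + 2 * cos \<theta>" .
  with e show "norm (1 + cis \<theta>) \<le> 2 * exp (- \<delta> / 4)" by - (rule power2_le_imp_le, auto)
  have "(norm (1 - cis \<theta>))\<^sup>2 = (1 - cos \<theta>)\<^sup>2 + (sin \<theta>)\<^sup>2"
    by (simp add: cmod_power2)
  also have "\<dots> = 2 - 2 * cos \<theta>"
    using sin_cos_squared_add[of \<theta>] by (simp add: power2_eq_square algebra_simps)
  finally have "(norm (1 - cis \<theta>))\<^sup>2 = 2 - 2 * cos \<theta>" .
  with e show "norm (1 - cis \<theta>) \<le> 2 * exp (- \<delta> / 4)" by - (rule power2_le_imp_le, auto)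
qed

text \<open>For odd \<open>j\<close> the primitive root \<open>- exp (i * pi / j)\<close> orders the characters so that the
  \<open>s\<close>-th one has \<open>\<bar>cos\<bar>\<close> of its argument equal to \<open>\<bar>cos (pi * s / j)\<bar>\<close>: only small \<open>s\<close> and small
  \<open>j - s\<close> contribute.\<close>

definition odd_root :: "nat \<Rightarrow> complex" where
  "odd_root j = cis (pi + pi / real j)"

lemma odd_root_power: "odd_root j ^ s = cis (real s * pi + pi * real s / real j)"
  by (simp add: odd_root_def Complex.DeMoivre algebra_simps)

lemma odd_root_power_period:
  assumes "odd j"
  shows "odd_root j ^ j = 1"
proof -
  have "j > 0" using assms by (rule odd_pos)
  then have "odd_root j ^ j = cis (real (j + 1) * pi)" by (simp add: odd_root_power algebra_simps)
  also have "\<dots> = cis pi ^ (j + 1)" by (subst Complex.DeMoivre) simp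
  also have "\<dots> = 1" using assms by (simp add: cis_pi)
  finally show ?thesis .
qed

text \<open>The multiple of \<open>pi\<close> only changes the sign of the cosine, and
  \<open>s\<close> may be reflected to \<open>j - s\<close>; for the smaller of the two the
  quadratic bound applies, with \<open>pi\<^sup>2 \<ge> 8\<close>.\<close>

lemma abs_cos_odd_root_arg:
  assumes j: "odd j" and s: "0 < s" "s < j"
  shows "\<bar>cos (real s * pi + pi * real s / real j)\<bar> \<le> 1 - (real (min s (j - s)) / real j)\<^sup>2"
proof -
  define d where "d = min s (j - s)"
  define x where "x = pi * real d / real j"
  have jpos: "j > 0" using s by simp
  have eq: "\<bar>cos (pi * real s / real j)\<bar> = \<bar>cos x\<bar>"
  proof (cases "s \<le> j - s")
    case True then show ?thesis by (simp add: x_def d_def)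
  next
    case False
    then have "x = pi - pi * real s / real j"
      using s jpos by (simp add: x_def d_def of_nat_diff field_simps)
    then show ?thesis by (simp add: cos_diff)
  qed
  have "\<bar>cos (real s * pi + pi * real s / real j)\<bar> = \<bar>cos (pi * real s / real j)\<bar>"
    by (simp add: cos_add abs_mult)
  also note eq
  also have d: "2 * d \<le> j" "d > 0" using s by (auto simp: d_def)
  then have "real d / real j \<le> 1 / 2" using jpos by (simp add: field_simps)
  then have x: "0 \<le> x" "x \<le> pi / 2"
    using mult_left_mono[of "real d / real j" "1 / 2" pi] by (auto simp: x_def)
  then have "\<bar>cos x\<bar> = cos x" using cos_ge_zero[of x] pi_gt_zero by simp
  also have "\<dots> \<le> 1 - x\<^sup>2 / 8" using x by (rule cos_le_one_minus_square)
  also have "\<dots> \<le> 1 - (real d / real j)\<^sup>2"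
  proof -
    have "9 \<le> pi\<^sup>2" using pi_gt3 power_mono[of 3 pi 2] by simp
    then have "8 * (real d / real j)\<^sup>2 \<le> pi\<^sup>2 * (real d / real j)\<^sup>2" by (intro mult_right_mono) auto
    then have "(real d / real j)\<^sup>2 \<le> pi\<^sup>2 * (real d / real j)\<^sup>2 / 8" by simp
    also have "\<dots> = x\<^sup>2 / 8" by (simp add: x_def power_mult_distrib power_divide)
    finally show ?thesis by simp
  qed
  finally show ?thesis by (simp add: d_def)
qed

text \<open>Orthogonality of characters as a geometric sum. If the ratio were 1, its imaginary part
  would force \<open>pi * d / j\<close> to be a multiple of \<open>pi\<close>.\<close>

lemma sum_odd_root_powers:
  assumes j: "odd j"
  shows "(\<Sum>s<j. (odd_root j ^ s) ^ d) = (if j dvd d then of_nat j else 0)"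
proof (cases "j dvd d")
  case True
  then obtain q where "d = j * q" by auto
  then have "(odd_root j ^ s) ^ d = ((odd_root j ^ j) ^ q) ^ s" for s
    by (simp add: power_mult[symmetric] mult_ac)
  then show ?thesis using True odd_root_power_period[OF j] by simp
next
  case False
  have jpos: "j > 0" using j by (rule odd_pos)
  have "odd_root j ^ d \<noteq> 1"
  proof
    assume "odd_root j ^ d = 1"
    then have "sin (real d * pi + pi * real d / real j) = 0"
      by (simp add: odd_root_power complex_eq_iff)
    then have "sin (pi * real d / real j) = 0" by (simp add: sin_add)
    then obtain i :: int where "pi * real d / real j = of_int i * pi" by (auto simp: sin_zero_iff_int2)
    then have "real d = of_int i * real j" using jpos pi_gt_zero by (simp add: field_simps)
    then have "int d = i * int j" by (metis of_int_eq_iff of_int_mult of_int_of_nat_eq)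
    then show False using False by (metis dvd_triv_right int_dvd_int_iff)
  qed
  moreover have "(\<Sum>s<j. (odd_root j ^ s) ^ d) = (\<Sum>s<j. (odd_root j ^ d) ^ s)"
    by (simp add: power_mult[symmetric] mult.commute)
  moreover have "(odd_root j ^ d) ^ j = 1"
    by (metis odd_root_power_period[OF j] mult.commute power_mult power_one)
  ultimately show ?thesis using False by (simp add: geometric_sum)
qed

section \<open>Functions of odd period\<close>

lemma sum_powers_le:
  fixes q :: real assumes q: "0 \<le> q" "q \<le> 1 / 2"
  shows "(\<Sum>s\<in>{1..<j}. q ^ s) \<le> 2 * q"
proof -
  \<comment> \<open>The factor \<open>1 - q ^ k\<close> makes the induction close, as
    \<open>1 \<le> 2 * (1 - q)\<close>.\<close>
  have "(\<Sum>s\<in>{1..<Suc k}. q ^ s) \<le> 2 * q * (1 - q ^ k)" for k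
  proof (induction k)
    case (Suc k)
    have "q ^ Suc k * 1 \<le> q ^ Suc k * (2 * (1 - q))" using q by (intro mult_left_mono) auto
    then show ?case using Suc by (simp add: algebra_simps)
  qed simp
  moreover have "2 * q * (1 - q ^ k) \<le> 2 * q" for k using q by (simp add: mult_left_le)
  ultimately have "(\<Sum>s\<in>{1..<Suc k}. q ^ s) \<le> 2 * q" for k by (rule order.trans)
  from this[of "j - 1"] show ?thesis using q by (cases j) auto
qed

text \<open>Fourier inversion on the integers modulo \<open>j\<close>; the exponent
  \<open>j - v\<close> stands for \<open>- v\<close>.\<close>

lemma periodic_character_expansion:
  fixes H :: "nat \<Rightarrow> real"
  assumes j: "odd j" and per: "\<And>w. H (w mod j) = H w"
  defines "C \<equiv> \<lambda>s. (\<Sum>v<j. of_real (H v) * (odd_root j ^ s) ^ (j - v)) / of_nat j"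
  shows "of_real (H w) = (\<Sum>s<j. C s * (odd_root j ^ s) ^ w)"
proof -
  have jpos: "j > 0" using j by (rule odd_pos)
  have dvd: "j dvd w + (j - v) \<longleftrightarrow> v = w mod j" if "v < j" for v
  proof
    assume "j dvd w + (j - v)"
    then obtain q where "w + (j - v) = j * q" by auto
    then have "w + j = v + j * q" using that by simp
    then have "(w + j) mod j = (v + j * q) mod j" by simp
    then show "v = w mod j" using that by simp
  next
    assume v: "v = w mod j"
    then have "w + (j - v) = j * (w div j) + j" using that
      by (metis add.commute add_diff_inverse_nat group_cancel.add2 less_or_eq_imp_le mult_div_mod_eq not_less)
    then show "j dvd w + (j - v)" by simp
  qed
  have "(\<Sum>s<j. C s * (odd_root j ^ s) ^ w)
      = (\<Sum>s<j. \<Sum>v<j. of_real (H v) / of_nat j * (odd_root j ^ s) ^ (w + (j - v)))"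
    unfolding C_def power_add sum_divide_distrib sum_distrib_right by (simp add: mult_ac)
  also have "\<dots> = (\<Sum>v<j. of_real (H v) / of_nat j * (\<Sum>s<j. (odd_root j ^ s) ^ (w + (j - v))))"
    by (subst sum.swap) (simp add: sum_distrib_left)
  also have "\<dots> = (\<Sum>v<j. if v = w mod j then of_real (H v) else 0)"
  proof (rule sum.cong[OF refl])
    fix v assume "v \<in> {..<j}"
    then show "of_real (H v) / of_nat j * (\<Sum>s<j. (odd_root j ^ s) ^ (w + (j - v)))
        = (if v = w mod j then of_real (H v) else (0::complex))"
      unfolding sum_odd_root_powers[OF j] using jpos dvd[of v] by simp
  qed
  also have "\<dots> = of_real (H w)" using jpos by (simp add: per)
  finally show ?thesis by simp
qed

text \<open>In the character expansion the trivial coefficient vanishes by \<open>zero\<close> and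
  the others are at most 2 by \<open>abs\<close>. The remaining forms sum to geometric series in
  \<open>q\<close> of total at most \<open>4 * q\<close>, doubled to 8 by the division by 2 in the
  claim.\<close>

lemma odd_periodic_form_bound:
  fixes H :: "nat \<Rightarrow> real"
  assumes j: "odd j" and per: "\<And>w. H (w mod j) = H w"
    and zero: "(\<Sum>v<j. H v) = 0" and abs: "(\<Sum>v<j. \<bar>H v\<bar>) \<le> 2 * real j" and n: "4 * j\<^sup>2 \<le> n"
  shows "(\<Sum>x\<in>cube n. \<Sum>y\<in>cube n. H (weight (map2 (\<noteq>) x y)) * a x * b y)
     \<le> (2 ^ n * 8 * exp (- (real n / (4 * (real j)\<^sup>2)))) * ((\<Sum>x\<in>cube n. (a x)\<^sup>2) + (\<Sum>y\<in>cube n. (b y)\<^sup>2)) / 2"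
proof -
  define T where "T = (\<Sum>x\<in>cube n. (a x)\<^sup>2) + (\<Sum>y\<in>cube n. (b y)\<^sup>2)"
  have T: "T \<ge> 0" by (simp add: T_def sum_nonneg)
  define q where "q = exp (- (real n / (4 * (real j)\<^sup>2)))"
  define C where "C = (\<lambda>s. (\<Sum>v<j. of_real (H v) * (odd_root j ^ s) ^ (j - v)) / of_nat j)"
  define F where "F = (\<lambda>s. \<Sum>x\<in>cube n. \<Sum>y\<in>cube n.
     (odd_root j ^ s) ^ weight (map2 (\<noteq>) x y) * of_real (a x) * of_real (b y))"
  have jpos: "j > 0" using j by (rule odd_pos)
  \<comment> \<open>This is where \<open>n\<close> must be at least \<open>4 * j\<^sup>2\<close>:
    the ratio of the geometric series has to be at most 1/2.\<close>
  have q: "0 \<le> q" "q \<le> 1 / 2"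
  proof -
    have "4 * (real j)\<^sup>2 \<le> real n" using n by (metis of_nat_le_iff of_nat_mult of_nat_numeral of_nat_power)
    then have "1 \<le> real n / (4 * (real j)\<^sup>2)" using jpos by (simp add: divide_simps)
    then have "q \<le> exp (- 1)" by (simp add: q_def)
    also have "\<dots> \<le> 1 / 2" using exp_ge_add_one_self[of 1] by (simp add: exp_minus field_simps)
    finally show "q \<le> 1 / 2" .
  qed (simp add: q_def)
  have C0: "C 0 = 0" by (simp add: C_def flip: of_real_sum) (simp add: zero)
  have C2: "norm (C s) \<le> 2" for s
  proof -
    have "norm (\<Sum>v<j. of_real (H v) * (odd_root j ^ s) ^ (j - v)) \<le> (\<Sum>v<j. \<bar>H v\<bar>)"
      by (rule sum_norm_le) (simp add: norm_mult norm_power odd_root_def)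
    also note abs
    finally show ?thesis using jpos by (simp add: C_def norm_divide divide_simps)
  qed
  have F: "norm (F s) \<le> 2 ^ n * (q ^ s + q ^ (j - s)) * T / 2" if s: "s \<in> {1..<j}" for s
  proof -
    define d where "d = min s (j - s)"
    have d: "1 \<le> d" using s by (auto simp: d_def)
    define \<delta> where "\<delta> = (real d / real j)\<^sup>2"
    have "\<bar>cos (real s * pi + pi * real s / real j)\<bar> \<le> 1 - \<delta>"
      unfolding \<delta>_def d_def using s by (intro abs_cos_odd_root_arg j) auto
    note \<mu> = norm_one_pm_cis[OF this]
    have "norm (F s) \<le> (2 * exp (- \<delta> / 4)) ^ n * T / 2"
      unfolding F_def T_def by (intro xor_power_form_bound) (use \<mu> in \<open>simp_all add: odd_root_power\<close>)
    also have "(2 * exp (- \<delta> / 4)) ^ n = 2 ^ n * exp (- (real n * \<delta> / 4))"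
      by (simp add: power_mult_distrib exp_of_nat_mult[symmetric])
    \<comment> \<open>Since \<open>d \<ge> 1\<close>, the quadratic exponent can be weakened to a
      linear one, which yields powers of \<open>q\<close>.\<close>
    also have "exp (- (real n * \<delta> / 4)) \<le> q ^ d"
    proof -
      have "real d * 1 \<le> real d * real d" using d by (intro mult_left_mono) auto
      then have "real d / (real j)\<^sup>2 \<le> \<delta>" by (simp add: \<delta>_def power_divide power2_eq_square divide_right_mono)
      then have "real n * (real d / (real j)\<^sup>2) \<le> real n * \<delta>" by (rule mult_left_mono) simp
      then show ?thesis by (simp add: q_def exp_of_nat_mult[symmetric] mult_ac)
    qed
    also have "q ^ d \<le> q ^ s + q ^ (j - s)" using q by (simp add: d_def min_def)
    finally show ?thesis using T by (simp add: mult_left_mono mult_right_mono divide_right_mono)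
  qed
  have char: "of_real (H w) = (\<Sum>s<j. C s * (odd_root j ^ s) ^ w)" for w
    unfolding C_def by (rule periodic_character_expansion[where H = H, OF j per])
  have "of_real (\<Sum>x\<in>cube n. \<Sum>y\<in>cube n. H (weight (map2 (\<noteq>) x y)) * a x * b y) =
     (\<Sum>x\<in>cube n. \<Sum>y\<in>cube n. \<Sum>s<j. C s * ((odd_root j ^ s) ^ weight (map2 (\<noteq>) x y) * of_real (a x) * of_real (b y)))"
    by (simp only: of_real_sum of_real_mult char sum_distrib_right mult.assoc)
  also have "\<dots> = (\<Sum>x\<in>cube n. \<Sum>s<j. \<Sum>y\<in>cube n. C s * ((odd_root j ^ s) ^ weight (map2 (\<noteq>) x y) * of_real (a x) * of_real (b y)))"
    by (intro sum.cong refl sum.swap)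
  also have "\<dots> = (\<Sum>s<j. C s * F s)"
    unfolding F_def sum_distrib_left by (rule sum.swap)
  finally have expand: "of_real (\<Sum>x\<in>cube n. \<Sum>y\<in>cube n. H (weight (map2 (\<noteq>) x y)) * a x * b y) = (\<Sum>s<j. C s * F s)" .
  have "(\<Sum>x\<in>cube n. \<Sum>y\<in>cube n. H (weight (map2 (\<noteq>) x y)) * a x * b y) \<le> norm (\<Sum>s<j. C s * F s)"
    unfolding expand[symmetric] norm_of_real by simp
  also have "(\<Sum>s<j. C s * F s) = (\<Sum>s\<in>{1..<j}. C s * F s)"
    by (intro sum.mono_neutral_right) (auto simp: C0 Suc_le_eq)
  also have "norm \<dots> \<le> (\<Sum>s\<in>{1..<j}. 2 * (2 ^ n * (q ^ s + q ^ (j - s)) * T / 2))"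
    by (rule sum_norm_le) (simp only: norm_mult, intro mult_mono C2 F; simp)
  also have "\<dots> = 2 ^ n * T * ((\<Sum>s\<in>{1..<j}. q ^ s) + (\<Sum>s\<in>{1..<j}. q ^ (j - s)))"
    unfolding sum.distrib[symmetric] sum_distrib_left by (intro sum.cong refl) (simp add: algebra_simps)
  also have "(\<Sum>s\<in>{1..<j}. q ^ (j - s)) = (\<Sum>s\<in>{1..<j}. q ^ s)"
    by (rule sum.reindex_bij_witness[of _ "\<lambda>s. j - s" "\<lambda>s. j - s"]) auto
  also have "2 ^ n * T * ((\<Sum>s\<in>{1..<j}. q ^ s) + (\<Sum>s\<in>{1..<j}. q ^ s)) \<le> 2 ^ n * T * (2 * q + 2 * q)"
    using T sum_powers_le[OF q] by (intro mult_left_mono add_mono) auto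
  finally show ?thesis by (simp add: q_def T_def mult_ac)
qed

text \<open>The term 3 is the binary logarithm of the factor 8 in the form bound; it also makes the
  claim trivial when \<open>n < 4 * j\<^sup>2\<close>.\<close>

lemma odd_periodic_protocol_cost:
  fixes G :: "'x \<Rightarrow> 'y \<Rightarrow> int" and h :: "nat \<Rightarrow> int"
  assumes p: "computes_with_advantage X Y G \<epsilon> p P Q" "\<epsilon> > 0"
    and G: "\<And>x y. G x y \<in> {-1, 1}"
    and enc: "\<And>x. x \<in> cube n \<Longrightarrow> f x \<in> X" "\<And>y. y \<in> cube n \<Longrightarrow> g y \<in> Y"
    and h: "\<And>x y. x \<in> cube n \<Longrightarrow> y \<in> cube n \<Longrightarrow> G (f x) (g y) = h (weight (map2 (\<noteq>) x y))"
    and range: "\<And>w. h w \<in> {-1, 1}"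
    and j: "odd j" and per: "\<And>w. h (w mod j) = h w" and nonconst: "h v1 \<noteq> h v2"
  shows "real n / (4 * (real j)\<^sup>2) - 3 \<le> real (cost p)"
proof (cases "4 * j\<^sup>2 \<le> n")
  case False
  then have "real n < 4 * (real j)\<^sup>2" by (metis not_le of_nat_less_iff of_nat_mult of_nat_numeral of_nat_power)
  then have "real n / (4 * (real j)\<^sup>2) < 1" by (simp add: divide_simps)
  then show ?thesis by simp
next
  case n: True
  define A where "A = {v. v < j \<and> h v = 1}"
  define B where "B = {v. v < j \<and> h v = - 1}"
  have fin: "finite A" "finite B" by (auto simp: A_def B_def)
  have jpos: "j > 0" using j by (rule odd_pos)
  have "h (v1 mod j) \<noteq> h (v2 mod j)" using nonconst by (simp add: per)
  then have ne: "A \<noteq> {}" "B \<noteq> {}"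
    using range[of "v1 mod j"] range[of "v2 mod j"] jpos unfolding A_def B_def
    by (auto intro: mod_less_divisor)
  have AB: "{..<j} = A \<union> B" "A \<inter> B = {}" using range unfolding A_def B_def by auto
  \<comment> \<open>Weights inverse to the sizes of the two value classes cancel over a period; the
    scale \<open>K\<close>, the larger size, keeps them at least 1 in absolute value and makes the
    absolute values sum to \<open>2 * K\<close>.\<close>
  define K where "K = max (real (card A)) (real (card B))"
  have cA: "real (card A) > 0" "real (card B) > 0" using fin ne by (simp_all add: card_gt_0_iff)
  have K: "K \<le> real j"
    using card_mono[of "{..<j}" A] card_mono[of "{..<j}" B] by (auto simp: K_def A_def B_def)
  define H where "H = (\<lambda>w. if h w = 1 then K / real (card A) else - (K / real (card B)))"
  have HA: "H v = K / real (card A)" if "v \<in> A" for v using that by (simp add: H_def A_def)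
  have HB: "H v = - (K / real (card B))" if "v \<in> B" for v using that by (simp add: H_def B_def)
  have "(\<Sum>v<j. H v) = (\<Sum>v\<in>A. H v) + (\<Sum>v\<in>B. H v)"
    unfolding AB(1) by (rule sum.union_disjoint) (use fin AB in auto)
  then have zero: "(\<Sum>v<j. H v) = 0" using cA by (simp add: HA HB)
  have "(\<Sum>v<j. \<bar>H v\<bar>) = (\<Sum>v\<in>A. \<bar>H v\<bar>) + (\<Sum>v\<in>B. \<bar>H v\<bar>)"
    unfolding AB(1) by (rule sum.union_disjoint) (use fin AB in auto)
  also have "\<dots> = 2 * K" using cA by (simp add: HA HB K_def)
  finally have abs: "(\<Sum>v<j. \<bar>H v\<bar>) \<le> 2 * real j" using K by simp
  have "2 ^ n \<le> (2 ^ n * 8 * exp (- (real n / (4 * (real j)\<^sup>2)))) * 2 ^ cost p"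
  proof (rule xor_protocol_lower_bound[OF p G enc])
    fix x y assume "x \<in> cube n" "y \<in> cube n"
    then have "G (f x) (g y) = h (weight (map2 (\<noteq>) x y))" by (rule h)
    then show "1 \<le> real_of_int (G (f x) (g y)) * H (weight (map2 (\<noteq>) x y))"
      using range[of "weight (map2 (\<noteq>) x y)"] cA by (auto simp: H_def K_def)
  next
    fix a b :: "bool list \<Rightarrow> real"
    show "(\<Sum>x\<in>cube n. \<Sum>y\<in>cube n. H (weight (map2 (\<noteq>) x y)) * a x * b y)
     \<le> (2 ^ n * 8 * exp (- (real n / (4 * (real j)\<^sup>2)))) * ((\<Sum>x\<in>cube n. (a x)\<^sup>2) + (\<Sum>y\<in>cube n. (b y)\<^sup>2)) / 2"
      by (rule odd_periodic_form_bound[OF j _ zero abs n]) (simp add: H_def per)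
  qed
  then have "exp (real n / (4 * (real j)\<^sup>2)) \<le> 2 ^ (cost p + 3)"
    by (simp add: exp_minus field_simps power_add)
  then have "real n / (4 * (real j)\<^sup>2) \<le> ln (2 ^ (cost p + 3))"
    by (subst ln_ge_iff) auto
  also have "\<dots> = real (cost p + 3) * ln 2" by (rule ln_realpow)
  also have "\<dots> \<le> real (cost p + 3) * 1" using ln_2_less_1 by (intro mult_left_mono) auto
  finally show ?thesis by simp
qed

section \<open>Period four and padding\<close>

text \<open>Adding the parity makes the argument of \<open>h\<close> even. Over \<open>w\<close>
  modulo 4 the values are then \<open>h 0\<close> times 1, -1, -1, 1, the real part of
  \<open>(1 + \<i>) * \<i> ^ w\<close>, so a single character with
  \<open>norm (1 + \<i>) = norm (1 - \<i>) = sqrt 2\<close> decides the bound.\<close>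

lemma parity_gadget_protocol_cost:
  fixes G :: "'x \<Rightarrow> 'y \<Rightarrow> int" and h :: "nat \<Rightarrow> int"
  assumes p: "computes_with_advantage X Y G \<epsilon> p P Q" "\<epsilon> > 0"
    and G: "\<And>x y. G x y \<in> {-1, 1}"
    and enc: "\<And>x. x \<in> cube n \<Longrightarrow> f x \<in> X" "\<And>y. y \<in> cube n \<Longrightarrow> g y \<in> Y"
    and h: "\<And>x y. x \<in> cube n \<Longrightarrow> y \<in> cube n \<Longrightarrow>
      G (f x) (g y) = h (weight (map2 (\<noteq>) x y) + weight (map2 (\<noteq>) x y) mod 2)"
    and range: "\<And>w. h w \<in> {-1, 1}" and per: "\<And>w. h (w mod 4) = h w" and nonconst: "h 0 \<noteq> h 2"
  shows "(real n - 1) / 2 \<le> real (cost p)"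
proof -
  define H where "H = (\<lambda>w. real_of_int (h (w + w mod 2)))"
  have H: "H w = h 0 * Re ((1 + \<i>) * \<i> ^ w)" for w
  proof -
    define r where "r = w mod 4"
    have r: "r < 4" by (simp add: r_def)
    have w: "w = 4 * (w div 4) + r" by (simp add: r_def)
    have "(w + w mod 2) mod 4 = (r + r mod 2) mod 4"
      unfolding r_def by (simp add: mod_mod_cancel mod_add_left_eq)
    then have "H w = h ((r + r mod 2) mod 4)" unfolding H_def by (metis per)
    moreover have "\<i> ^ w = \<i> ^ r" by (subst w) (simp add: power_add power_mult)
    moreover have "h 2 = - h 0" using nonconst range[of 0] range[of 2] by auto
    moreover have "real_of_int (h ((r + r mod 2) mod 4)) = h 0 * Re ((1 + \<i>) * \<i> ^ r)"
    proof -
      consider "r = 0" | "r = 1" | "r = 2" | "r = 3" using r by linarith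
      then show ?thesis
        by cases (simp_all add: \<open>h 2 = - h 0\<close> power3_eq_cube numeral_2_eq_2[symmetric])
    qed
    ultimately show ?thesis by simp
  qed
  have "2 ^ n \<le> (sqrt 2 * sqrt 2 ^ n) * 2 ^ cost p"
  proof (rule xor_protocol_lower_bound[OF p G enc])
    fix x y assume "x \<in> cube n" "y \<in> cube n"
    then show "1 \<le> real_of_int (G (f x) (g y)) * H (weight (map2 (\<noteq>) x y))"
      using h[of x y] range[of "weight (map2 (\<noteq>) x y) + weight (map2 (\<noteq>) x y) mod 2"] by (auto simp: H_def)
  next
    fix a b :: "bool list \<Rightarrow> real"
    define F where "F = (\<Sum>x\<in>cube n. \<Sum>y\<in>cube n. \<i> ^ weight (map2 (\<noteq>) x y) * of_real (a x) * of_real (b y))"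
    define T where "T = (\<Sum>x\<in>cube n. (a x)\<^sup>2) + (\<Sum>y\<in>cube n. (b y)\<^sup>2)"
    have norms: "norm (1 + \<i>) = sqrt 2" "norm (1 - \<i>) = sqrt 2" by (simp_all add: cmod_def)
    have F: "norm F \<le> sqrt 2 ^ n * T / 2"
      unfolding F_def T_def by (rule xor_power_form_bound) (simp_all add: norms)
    have "(\<Sum>x\<in>cube n. \<Sum>y\<in>cube n. H (weight (map2 (\<noteq>) x y)) * a x * b y) = h 0 * Re ((1 + \<i>) * F)"
      unfolding H F_def sum_distrib_left Re_sum of_int_sum
      by (intro sum.cong refl) (simp add: algebra_simps)
    also have "\<dots> \<le> norm ((1 + \<i>) * F)"
      using range[of 0] abs_Re_le_cmod[of "(1 + \<i>) * F"] by auto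
    also have "\<dots> = sqrt 2 * norm F" by (simp only: norm_mult norms)
    also have "\<dots> \<le> sqrt 2 * (sqrt 2 ^ n * T / 2)" using F by (intro mult_left_mono) auto
    finally show "(\<Sum>x\<in>cube n. \<Sum>y\<in>cube n. H (weight (map2 (\<noteq>) x y)) * a x * b y)
      \<le> (sqrt 2 * sqrt 2 ^ n) * ((\<Sum>x\<in>cube n. (a x)\<^sup>2) + (\<Sum>y\<in>cube n. (b y)\<^sup>2)) / 2"
      by (simp add: T_def)
  qed
  \<comment> \<open>Everything becomes a power of \<open>sqrt 2\<close>, so that exponents can be
    compared.\<close>
  moreover have two: "(2::real) ^ k = sqrt 2 ^ (2 * k)" for k by (simp add: power_mult)
  ultimately have "sqrt 2 ^ (2 * n) \<le> sqrt 2 ^ (1 + n + 2 * cost p)" by (simp add: power_add two)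
  then have "2 * n \<le> 1 + n + 2 * cost p" by (rule power_le_imp_le_exp[rotated]) simp
  then have "real n \<le> real (1 + 2 * cost p)" by (subst of_nat_le_iff) linarith
  then show ?thesis by simp
qed

text \<open>A protocol of cost 0 has a constant output and is wrong with certainty on one of the two
  inputs. The bound serves to absorb additive constants.\<close>

lemma nonconstant_protocol_cost:
  assumes p: "computes_with_advantage X Y G \<epsilon> p P Q" "\<epsilon> > 0"
    and xy: "x1 \<in> X" "x2 \<in> X" "y \<in> Y" "G x1 y \<noteq> G x2 y"
  shows "1 \<le> cost p"
proof (cases p)
  case (Output v)
  have "v = G x y" if "x \<in> X" for x
  proof (rule ccontr)
    assume "v \<noteq> G x y"
    then have "measure_pmf.prob (pair_pmf P Q) {(r, s). run p x y r s = G x y} = 0" by (simp add: Output)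
    moreover have "measure_pmf.prob (pair_pmf P Q) {(r, s). run p x y r s = G x y} \<ge> 1 / 2 + \<epsilon>"
      using p(1) that xy(3) by (simp add: computes_with_advantage_def)
    ultimately show False using p(2) by simp
  qed
  then show ?thesis using xy by metis
qed simp_all

section \<open>Encodings by repetition and padding\<close>

text \<open>Repetition multiplies the weight of the XOR by \<open>e\<close>. Padding with
  \<open>True\<close> on one side and \<open>False\<close> on the other shifts it by
  \<open>a\<close>; the final block agrees on both sides.\<close>

definition repeat_pad :: "nat \<Rightarrow> nat \<Rightarrow> nat \<Rightarrow> bool \<Rightarrow> bool list \<Rightarrow> bool list" where
  "repeat_pad n e a b x = concat (map (replicate e) x) @ replicate a b @ replicate (n - e * length x - a) False"

lemma length_concat_replicate: "length (concat (map (replicate e) x)) = e * length x"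
  by (induction x) auto

lemma repeat_pad_in_cube: "e * length x + a \<le> n \<Longrightarrow> repeat_pad n e a b x \<in> cube n"
  by (simp add: cube_def repeat_pad_def length_concat_replicate)

lemma weight_xor_concat_replicate:
  "length x = length y \<Longrightarrow>
   weight (map2 (\<noteq>) (concat (map (replicate e) x)) (concat (map (replicate e) y))) = e * weight (map2 (\<noteq>) x y)"
  by (induction x y rule: list_induct2) (auto simp: zip_replicate map_replicate)

lemma weight_xor_repeat_pad:
  assumes "length x = length y"
  shows "weight (map2 (\<noteq>) (repeat_pad n e a True x) (repeat_pad n e a False y)) = e * weight (map2 (\<noteq>) x y) + a"
  using assms weight_xor_concat_replicate[OF assms, of e]
  by (simp add: repeat_pad_def length_concat_replicate zip_replicate)

text \<open>Each player knows the parity of their own string, and the XOR of the two parities is the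
  parity of the XOR, so no communication is spent on the extra bit.\<close>

lemma weight_xor_snoc_parity:
  assumes "length x = length y"
  shows "weight (map2 (\<noteq>) (x @ [odd (weight x)]) (y @ [odd (weight y)]))
    = weight (map2 (\<noteq>) x y) + weight (map2 (\<noteq>) x y) mod 2"
proof -
  have "weight (map2 (\<noteq>) (x @ [odd (weight x)]) (y @ [odd (weight y)]))
    = weight (map2 (\<noteq>) x y) + of_bool (odd (weight x) \<noteq> odd (weight y))"
    using assms by simp
  then show ?thesis unfolding mod_2_eq_odd odd_weight_xor[OF assms] .
qed

section \<open>Reduction of the modulus\<close>

definition mod_sign :: "nat \<Rightarrow> nat set \<Rightarrow> nat \<Rightarrow> int" where
  "mod_sign m A i = (if \<exists>a\<in>A. [i = a] (mod m) then - 1 else 1)"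

lemma mod_fn_eq_mod_sign: "mod_fn m A x = mod_sign m A (weight x)"
  by (simp add: mod_fn_def mod_sign_def)

lemma mod_sign_range: "mod_sign m A i \<in> {-1, 1}"
  by (simp add: mod_sign_def)

lemma mod_sign_period: "mod_sign m A (i + m) = mod_sign m A i"
  by (simp add: mod_sign_def cong_def)

lemma periodic_add_mult:
  fixes h :: "nat \<Rightarrow> 'a"
  assumes "\<And>i. h (i + d) = h i"
  shows "h (i + d * q) = h i"
proof (induction q)
  case (Suc q)
  have "h (i + d * Suc q) = h ((i + d * q) + d)" by (simp add: algebra_simps)
  then show ?case using assms Suc by simp
qed simp

lemma periodic_mod:
  fixes h :: "nat \<Rightarrow> 'a"
  assumes "\<And>i. h (i + d) = h i"
  shows "h (i mod d) = h i"
  using periodic_add_mult[of h d "i mod d" "i div d", OF assms] by simp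

text \<open>With period 1 or 2 the value depends only on the parity of the weight, which leaves a
  constant function, parity or its negation.\<close>

lemma period_ge_4:
  assumes n: "\<not> simple_accepting n m A" and per: "\<And>i. mod_sign m A (i + 2 ^ l) = mod_sign m A i"
  shows "2 \<le> l"
proof (rule ccontr)
  assume "\<not> 2 \<le> l"
  then have "l = 0 \<or> l = 1" by linarith
  then have per2: "mod_sign m A (i + 2) = mod_sign m A i" for i
    using per[of i] per[of "Suc i"] by (auto simp: numeral_2_eq_2)
  have eq: "mod_sign m A i = mod_sign m A (of_bool (odd i))" for i
    using periodic_mod[of "mod_sign m A" 2 i, OF per2] by (simp add: mod_2_eq_odd)
  have "mod_sign m A 0 = mod_sign m A 1 \<or> mod_sign m A 0 = 1 \<and> mod_sign m A 1 = - 1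
    \<or> mod_sign m A 0 = - 1 \<and> mod_sign m A 1 = 1"
    using mod_sign_range[of m A 0] mod_sign_range[of m A 1] by auto
  then show False
  proof (elim disjE conjE)
    assume "mod_sign m A 0 = mod_sign m A 1"
    then have "mod_fn m A x = mod_sign m A 0" for x
      using eq[of "weight x"] by (cases "odd (weight x)") (simp_all add: mod_fn_eq_mod_sign)
    then show False using n unfolding simple_accepting_def by blast
  next
    assume "mod_sign m A 0 = 1" "mod_sign m A 1 = - 1"
    then have "mod_fn m A x = parity x" for x
      using eq[of "weight x"] by (cases "odd (weight x)") (simp_all add: mod_fn_eq_mod_sign parity_def)
    then show False using n unfolding simple_accepting_def by blast
  next
    assume "mod_sign m A 0 = - 1" "mod_sign m A 1 = 1"
    then have "mod_fn m A x = - parity x" for x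
      using eq[of "weight x"] by (cases "odd (weight x)") (simp_all add: mod_fn_eq_mod_sign parity_def)
    then show False using n unfolding simple_accepting_def by blast
  qed
qed

section \<open>Cost bounds for the modular function\<close>

text \<open>With the zero string for the second player the composed function is
  \<open>mod_fn m A\<close> itself, which is not constant.\<close>

lemma nonsimple_protocol_cost_pos:
  assumes p: "computes_with_advantage (cube n) (cube n) (xor_comp (mod_fn m A)) \<epsilon> p P Q" "\<epsilon> > 0"
    and n: "\<not> simple_accepting n m A"
  shows "1 \<le> cost p"
proof -
  let ?z = "replicate n False"
  have "map2 (\<noteq>) x ?z = x" if "length x = n" for x
    using that by (induction x arbitrary: n) (auto simp: length_Suc_conv)
  then have xor: "xor_comp (mod_fn m A) x ?z = mod_fn m A x" if "x \<in> cube n" for x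
    using that by (simp add: xor_comp_def cube_def)
  have "\<exists>x\<in>cube n. mod_fn m A x \<noteq> mod_fn m A ?z" using n unfolding simple_accepting_def by blast
  then obtain x where x: "x \<in> cube n" "mod_fn m A x \<noteq> mod_fn m A ?z" by blast
  have z: "?z \<in> cube n" by (simp add: cube_def)
  show ?thesis
    by (rule nonconstant_protocol_cost[OF p x(1) z z]) (simp add: xor x z)
qed

text \<open>Repeating each bit \<open>2 ^ k\<close> times samples the period \<open>m\<close> in
  steps of \<open>2 ^ k\<close>, which leaves the odd period \<open>j\<close>; the hypothesis on
  \<open>a\<close> keeps the sample nonconstant.\<close>

lemma aperiodic_mod_protocol_cost:
  assumes p: "computes_with_advantage (cube n) (cube n) (xor_comp (mod_fn m A)) \<epsilon> p P Q" "\<epsilon> > 0"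
    and m: "m = j * 2 ^ k" "odd j" "m < n" and j: "3 \<le> j"
    and a: "mod_sign m A (a + 2 ^ k) \<noteq> mod_sign m A a"
  shows "real n / 2 ^ k / (12 * (real j)\<^sup>2) - 3 \<le> real (cost p)"
proof -
  define e where "e = (2::nat) ^ k"
  have e: "e > 0" by (simp add: e_def)
  \<comment> \<open>With this shift the sampled progression passes through \<open>a\<close> and
    \<open>a + e\<close>.\<close>
  define b where "b = a mod e"
  define h where "h = (\<lambda>i. mod_sign m A (e * i + b))"
  define n' where "n' = (n - b) div e"
  have b: "b < e" using e by (simp add: b_def)
  have je: "3 * e \<le> j * e" using j by simp
  then have n3: "3 * e < n" using m(3) unfolding m(1) e_def by (rule le_less_trans)
  have "e * n' \<le> n - b" by (simp add: n'_def)
  then have fit: "e * n' + b \<le> n" using b n3 by linarith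
  have per: "h (i mod j) = h i" for i
  proof (rule periodic_mod)
    fix i have "e * (i + j) + b = (e * i + b) + m" by (simp add: m e_def algebra_simps)
    then show "h (i + j) = h i" unfolding h_def by (metis mod_sign_period)
  qed
  have "e * (a div e) + b = a" by (simp add: b_def)
  moreover have "e * (a div e + 1) + b = a + e" by (simp add: b_def algebra_simps)
  ultimately have nonconst: "h (a div e + 1) \<noteq> h (a div e)"
    using a unfolding h_def e_def[symmetric] by metis
  have enc: "repeat_pad n e b c x \<in> cube n" if "x \<in> cube n'" for c x
    using that fit by (intro repeat_pad_in_cube) (simp add: cube_def)
  have "real n' / (4 * (real j)\<^sup>2) - 3 \<le> real (cost p)"
  proof (rule odd_periodic_protocol_cost[OF p, where f = "repeat_pad n e b True" and g = "repeat_pad n e b False" and h = h])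
    fix x y show "xor_comp (mod_fn m A) x y \<in> {-1, 1}"
      unfolding xor_comp_def mod_fn_eq_mod_sign by (rule mod_sign_range)
  next
    fix x y assume "x \<in> cube n'" "y \<in> cube n'"
    then have "length x = length y" by (simp add: cube_def)
    from weight_xor_repeat_pad[OF this]
    show "xor_comp (mod_fn m A) (repeat_pad n e b True x) (repeat_pad n e b False y) = h (weight (map2 (\<noteq>) x y))"
      unfolding xor_comp_def mod_fn_eq_mod_sign h_def by simp
  next
    show "h w \<in> {-1, 1}" for w unfolding h_def by (rule mod_sign_range)
  qed (use m(2) per nonconst enc in auto)
  \<comment> \<open>Rounding: \<open>n < e * n' + 2 * e\<close> and \<open>n' \<ge> 1\<close>, so at
    most a factor 3 is lost.\<close>
  moreover have "real n / 2 ^ k / 3 \<le> real n'"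
  proof -
    have "n < e * n' + e + b" using e dividend_less_div_times[of e "n - b"] fit
      unfolding n'_def by (simp add: mult.commute)
    moreover have "3 * e * 1 \<le> 3 * (e * n')"
    proof -
      have "1 \<le> n'" unfolding n'_def using e b n3 by (simp add: Suc_le_eq div_greater_zero_iff)
      then show ?thesis using e by simp
    qed
    ultimately have "n \<le> 3 * e * n'" using b by linarith
    then have "real n \<le> real (3 * e * n')" by (simp only: of_nat_le_iff)
    then have "real n \<le> 3 * 2 ^ k * real n'" by (simp add: e_def)
    then show ?thesis by (simp add: divide_simps mult_ac)
  qed
  then have "real n / 2 ^ k / 3 / (4 * (real j)\<^sup>2) \<le> real n' / (4 * (real j)\<^sup>2)"
    by (intro divide_right_mono) auto
  ultimately show ?thesis by simp
qed

text \<open>For \<open>e = 2 ^ l\<close>, where \<open>4 * e\<close> is a period and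
  \<open>2 * e\<close> is not, sampling in steps of \<open>e\<close> at a suitable shift gives
  period 4 with \<open>h 0 \<noteq> h 2\<close>, the situation of the parity gadget.\<close>

lemma dyadic_mod_protocol_cost:
  assumes p: "computes_with_advantage (cube n) (cube n) (xor_comp (mod_fn m A)) \<epsilon> p P Q" "\<epsilon> > 0"
    and n: "3 * 2 ^ l < n"
    and per: "\<And>i. mod_sign m A (i + 2 ^ (l + 2)) = mod_sign m A i"
    and a: "mod_sign m A (a + 2 ^ (l + 1)) \<noteq> mod_sign m A a"
  shows "(real n / 2 ^ l - 5) / 2 \<le> real (cost p)"
proof -
  define e where "e = (2::nat) ^ l"
  have e: "e > 0" by (simp add: e_def)
  have per: "mod_sign m A (i + 4 * e) = mod_sign m A i" for i using per[of i] by (simp add: e_def algebra_simps)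
  \<comment> \<open>The shift must stay below \<open>2 * e\<close> to cost little padding. A residue
    from the upper half is moved down by \<open>2 * e\<close>: by periodicity this swaps the two
    compared values.\<close>
  have "\<exists>b<2 * e. mod_sign m A (b + 2 * e) \<noteq> mod_sign m A b"
  proof -
    define c where "c = a mod (4 * e)"
    have "a + 2 * e = (c + 2 * e) + 4 * e * (a div (4 * e))" by (simp add: c_def)
    then have "mod_sign m A (a + 2 * e) = mod_sign m A (c + 2 * e)"
      using periodic_add_mult[of "mod_sign m A", OF per] by metis
    moreover have "mod_sign m A c = mod_sign m A a"
      unfolding c_def by (rule periodic_mod[of "mod_sign m A", OF per])
    ultimately have c: "mod_sign m A (c + 2 * e) \<noteq> mod_sign m A c" using a by (simp add: e_def mult.commute)
    show ?thesis
    proof (cases "c < 2 * e")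
      case True then show ?thesis using c by blast
    next
      case False
      have "mod_sign m A ((c - 2 * e) + 4 * e) \<noteq> mod_sign m A ((c - 2 * e) + 2 * e)"
        using c False by (simp add: algebra_simps)
      moreover have "c - 2 * e < 2 * e"
      proof -
        have "c < 4 * e" using e by (simp add: c_def)
        then show ?thesis using False by linarith
      qed
      ultimately show ?thesis using per by metis
    qed
  qed
  then obtain b where b: "b < 2 * e" "mod_sign m A (b + 2 * e) \<noteq> mod_sign m A b" by blast
  define h where "h = (\<lambda>i. mod_sign m A (e * i + b))"
  \<comment> \<open>One repeated block is reserved for the parity bit.\<close>
  define n' where "n' = (n - b) div e - 1"
  have n3: "3 * e < n" using n by (simp add: e_def)
  then have "1 \<le> (n - b) div e" using e b by (simp add: Suc_le_eq div_greater_zero_iff)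
  then have n': "n' + 1 = (n - b) div e" by (simp add: n'_def)
  have "e * (n' + 1) \<le> n - b" unfolding n' by simp
  then have fit: "e * (n' + 1) + b \<le> n" using b n3 by linarith
  let ?f = "\<lambda>c x. repeat_pad n e b c (x @ [odd (weight x)])"
  have enc: "?f c x \<in> cube n" if "x \<in> cube n'" for c x
    using that fit by (intro repeat_pad_in_cube) (simp add: cube_def)
  have "(real n' - 1) / 2 \<le> real (cost p)"
  proof (rule parity_gadget_protocol_cost[OF p, where f = "?f True" and g = "?f False" and h = h])
    fix x y show "xor_comp (mod_fn m A) x y \<in> {-1, 1}"
      unfolding xor_comp_def mod_fn_eq_mod_sign by (rule mod_sign_range)
  next
    fix x y assume "x \<in> cube n'" "y \<in> cube n'"
    then have len: "length x = length y" by (simp add: cube_def)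
    show "xor_comp (mod_fn m A) (?f True x) (?f False y) = h (weight (map2 (\<noteq>) x y) + weight (map2 (\<noteq>) x y) mod 2)"
      unfolding xor_comp_def mod_fn_eq_mod_sign h_def weight_xor_snoc_parity[OF len, symmetric]
      by (subst weight_xor_repeat_pad) (simp_all add: len)
  next
    show "h w \<in> {-1, 1}" for w unfolding h_def by (rule mod_sign_range)
  next
    show "h (w mod 4) = h w" for w
    proof (rule periodic_mod)
      fix i show "h (i + 4) = h i" using per[of "e * i + b"] unfolding h_def by (simp add: algebra_simps)
    qed
  next
    show "h 0 \<noteq> h 2" using b(2) by (simp add: h_def add.commute mult.commute)
  qed (use enc in auto)
  moreover have "real n / 2 ^ l \<le> real n' + 4"
  proof -
    have "n - b < e * (n' + 1) + e" using e dividend_less_div_times[of e "n - b"]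
      unfolding n' by (simp add: mult.commute)
    then have "n \<le> (n' + 4) * e" using b n3 by (simp add: algebra_simps)
    then have "real n \<le> real ((n' + 4) * e)" by (simp only: of_nat_le_iff)
    then have "real n \<le> (real n' + 4) * 2 ^ l" by (simp add: e_def)
    then show ?thesis by (simp add: divide_simps)
  qed
  ultimately show ?thesis by simp
qed

text \<open>If \<open>j\<close> is odd and \<open>2 ^ k\<close> is not a period, the odd case
  applies. Otherwise some power of two up to \<open>2 ^ (k + 2)\<close> is a period, and the least
  one gives the dyadic case.\<close>

lemma mod_protocol_cost:
  assumes p: "computes_with_advantage (cube n) (cube n) (xor_comp (mod_fn m A)) \<epsilon> p P Q" "\<epsilon> > 0"
    and m: "m = j * 2 ^ k" "m < n" and j: "odd j \<and> 3 \<le> j \<or> j = 4"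
    and ns: "\<not> simple_accepting n m A"
  shows "real n / 2 ^ k / (48 * (real j)\<^sup>2) \<le> real (cost p)"
proof -
  have cost1: "1 \<le> real (cost p)" using nonsimple_protocol_cost_pos[OF p ns] by simp
  have per: "mod_sign m A (i + j * 2 ^ k) = mod_sign m A i" for i using mod_sign_period m(1) by metis
  show ?thesis
  proof (cases "odd j \<and> (\<exists>a. mod_sign m A (a + 2 ^ k) \<noteq> mod_sign m A a)")
    case True
    then obtain a where a: "odd j" "mod_sign m A (a + 2 ^ k) \<noteq> mod_sign m A a" by blast
    then have "3 \<le> j" using j by auto
    define t where "t = real n / 2 ^ k / (12 * (real j)\<^sup>2)"
    have "t - 3 \<le> real (cost p)"
      unfolding t_def by (rule aperiodic_mod_protocol_cost[OF p m(1) a(1) m(2) \<open>3 \<le> j\<close> a(2)])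
    \<comment> \<open>Cost at least 1 turns \<open>cost p + 3\<close> into
      \<open>4 * cost p\<close>; with the 12 in \<open>t\<close> this produces 48.\<close>
    then have "t / 4 \<le> real (cost p)" using cost1 by linarith
    then show ?thesis by (simp add: t_def)
  next
    case False
    have "\<exists>l\<le>k + 2. \<forall>i. mod_sign m A (i + 2 ^ l) = mod_sign m A i"
    proof (cases "odd j")
      case True
      then show ?thesis using False by (intro exI[of _ k]) auto
    next
      case False
      then have "j * 2 ^ k = 2 ^ (k + 2)" using j by (simp add: power_add)
      then show ?thesis using per by (intro exI[of _ "k + 2"]) auto
    qed
    then obtain l0 where l0: "l0 \<le> k + 2" "\<forall>i. mod_sign m A (i + 2 ^ l0) = mod_sign m A i" by blast
    \<comment> \<open>Minimality makes half the period fail, and non-simplicity makes the exponent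
      at least 2, so that it can be written as \<open>l' + 2\<close>.\<close>
    define l where "l = (LEAST l. \<forall>i. mod_sign m A (i + 2 ^ l) = mod_sign m A i)"
    have l: "\<forall>i. mod_sign m A (i + 2 ^ l) = mod_sign m A i" "l \<le> l0"
      unfolding l_def by (rule LeastI[of _ l0], rule l0(2)) (rule Least_le, rule l0(2))
    have "2 \<le> l" using l(1) by (intro period_ge_4[OF ns]) blast
    define l' where "l' = l - 2"
    have l': "l = l' + 2" "l' \<le> k" using \<open>2 \<le> l\<close> l(2) l0(1) by (auto simp: l'_def)
    have "\<not> (\<forall>i. mod_sign m A (i + 2 ^ (l' + 1)) = mod_sign m A i)"
      unfolding l_def by (rule not_less_Least) (simp add: l_def[symmetric] l')
    then obtain a where a: "mod_sign m A (a + 2 ^ (l' + 1)) \<noteq> mod_sign m A a" by blast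
    have pow: "(2::nat) ^ l' \<le> 2 ^ k" using l'(2) by (intro power_increasing) auto
    have "3 * 2 ^ k \<le> m" using j unfolding m(1) by (intro mult_right_mono) auto
    then have small: "3 * 2 ^ l' < n" using pow m(2) by linarith
    have "(real n / 2 ^ l' - 5) / 2 \<le> real (cost p)"
      by (rule dyadic_mod_protocol_cost[OF p small _ a]) (use l l' in auto)
    then have "real n / 2 ^ l' \<le> 12 * real (cost p)" using cost1 by argo
    then have "real n / 2 ^ l' / 12 \<le> real (cost p)" by simp
    moreover have "real n / 2 ^ k / (48 * (real j)\<^sup>2) \<le> real n / 2 ^ l' / 12"
    proof -
      have "(2::real) ^ l' \<le> 2 ^ k" using l'(2) by (intro power_increasing) auto
      then have le: "real n / 2 ^ k \<le> real n / 2 ^ l'" by (intro divide_left_mono) auto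
      have "1 \<le> (real j)\<^sup>2" using j by (intro one_le_power) auto
      then show ?thesis by (intro frac_le le) auto
    qed
    ultimately show ?thesis by linarith
  qed
qed

section \<open>From protocol costs to unbounded-error complexity\<close>

text \<open>Costs are natural numbers, so the infimum in \<open>enat\<close> can be compared with
  the ceiling of \<open>B\<close>; an infimum over no protocols is infinite and satisfies the bound
  too.\<close>

lemma UPP_ge_of_cost_ge:
  assumes "\<And>\<epsilon> p P Q. \<epsilon> > 0 \<Longrightarrow> computes_with_advantage X Y G \<epsilon> p P Q \<Longrightarrow> B \<le> real (cost p)"
  shows "ereal B \<le> ereal_of_enat (UPP X Y G)"
proof -
  have "enat (nat \<lceil>B\<rceil>) \<le> UPP X Y G"
    unfolding UPP_def R_cc_def
    by (intro INF_greatest Inf_greatest) (use assms in \<open>auto simp: nat_le_iff ceiling_le_iff\<close>)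
  then have "ereal_of_enat (enat (nat \<lceil>B\<rceil>)) \<le> ereal_of_enat (UPP X Y G)"
    by (simp only: ereal_of_enat_le_iff)
  moreover have "ereal B \<le> ereal_of_enat (enat (nat \<lceil>B\<rceil>))" by (simp add: real_nat_ceiling_ge)
  ultimately show ?thesis by (rule order.trans[rotated])
qed

theorem mainTheorem7:
  "\<exists>c::real. c > 0 \<and>
     (\<forall>(m::nat) (j::nat) (k::nat) (n::nat) (A::nat set).
        m \<ge> 3 \<longrightarrow> m < n \<longrightarrow> m = j * 2 ^ k \<longrightarrow> (odd j \<and> j \<ge> 3) \<or> j = 4 \<longrightarrow>
        A \<subseteq> {0..<m} \<longrightarrow> \<not> simple_accepting n m A \<longrightarrow>
        ereal_of_enat (UPP (cube n) (cube n) (xor_comp (mod_fn m A)))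
          \<ge> ereal (c * ((real n - real k * real m) / (real j * real m))
                   - 2 * real j * log 2 (real j) / real m))"
proof (rule exI[of _ "1 / 48"], intro conjI allI impI)
  fix m j k n :: nat and A :: "nat set"
  assume m: "m = j * 2 ^ k" "m < n" and j: "odd j \<and> 3 \<le> j \<or> j = 4" and ns: "\<not> simple_accepting n m A"
  have j3: "3 \<le> j" using j by auto
  show "ereal (1 / 48 * ((real n - real k * real m) / (real j * real m)) - 2 * real j * log 2 (real j) / real m)
    \<le> ereal_of_enat (UPP (cube n) (cube n) (xor_comp (mod_fn m A)))"
  proof (rule UPP_ge_of_cost_ge)
    fix \<epsilon> :: real and p :: "(bool list, bool list, int) protocol" and P Q
    assume p: "\<epsilon> > 0" "computes_with_advantage (cube n) (cube n) (xor_comp (mod_fn m A)) \<epsilon> p P Q"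
    \<comment> \<open>Both subtracted terms are nonnegative, so it suffices to bound the cost by
      \<open>n / (48 * j * m)\<close>, where \<open>j * m = j\<^sup>2 * 2 ^ k\<close>.\<close>
    have "0 \<le> log 2 (real j)" using j3 by (subst zero_le_log_cancel_iff) auto
    then have "0 \<le> 2 * real j * log 2 (real j) / real m" by simp
    moreover have "1 / 48 * ((real n - real k * real m) / (real j * real m)) \<le> 1 / 48 * (real n / (real j * real m))"
      by (intro mult_left_mono divide_right_mono) auto
    moreover have "1 / 48 * (real n / (real j * real m)) = real n / 2 ^ k / (48 * (real j)\<^sup>2)"
      by (simp add: m(1) power2_eq_square mult_ac)
    ultimately show "1 / 48 * ((real n - real k * real m) / (real j * real m)) - 2 * real j * log 2 (real j) / real m
        \<le> real (cost p)"
      using mod_protocol_cost[OF p(2,1) m j ns] by linarith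
  qed
qed simp

end
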